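(* Let $\Gamma$ be a finite simple graph and let $P$ be a finite nonempty connected $\Gamma$-colored poset. If $P$ is $\Gamma$-colored $d$-complete or $\Gamma$-colored minuscule, then $P$ is standard; that is, for every integer $m\ge 1$ and every linear extension of $P$, the $m$-stackwise vectors are linearly independent and every element of $\mathcal{V}^m$ is an integer linear combination of $m$-stackwise vectors.
   Context: A $\Gamma$-colored poset is a finite poset $P$ with a surjective map $\kappa:P\to\Gamma$ onto the vertex set ("colors") of a finite simple graph $\Gamma$; distinct colors $a,b$ are adjacent ($a\sim b$) if joined by an edge, distant otherwise. $x\to y$ means $y$ covers $x$; covering pairs are neighbors. For $a\in\Gamma$ let $P_a=\kappa^{-1}(a)$; $x<y$ in $P_a$ are consecutive of color $a$ if no element of color $a$ lies in the open interval $(x,y)$. Axioms: (EC) elements of equal color are comparable; (NA) neighbors have adjacent colors; (AC) elements with adjacent colors are comparable; (ICE2) for consecutive $x<y$ of color $a$, the interval $(x,y)$ contains exactly two elements whose colors are adjacent to $a$; (UCB1) if $x$ is maximal in $P_a$, at most one element greater than $x$ has color adjacent to $a$; (LCB1) if $x$ is minimal in $P_a$, at most one element less than $x$ has color adjacent to $a$. $P$ is $\Gamma$-colored $d$-complete if it satisfies EC, NA, AC, ICE2, UCB1, and $\Gamma$-colored minuscule if in addition it satisfies LCB1. Operators: for an order ideal $I$ of $P$ and $a\in\Gamma$, $X_a.I=\sum I\cup\{x\}$, summed over minimal elements $x$ of $P-I$ of color $a$ (a formal sum of ideals; $0$ if there are none). For $m\ge1$, an $m$-multiset of ideals $\{I_1,\dots,I_m\}$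 is an unordered multiset of $m$ ideals; $m$-vectors are elements of the complex vector space with these multisets as basis. Set $X_a.\{I_1,\dots,I_m\}=\sum_{j=1}^m\{I_1,\dots,X_a.I_j,\dots,I_m\}$ (extended multilinearly/linearly) and $\langle a^k\rangle=\frac1{k!}X_a^k$, with $\langle a^0\rangle$ the identity. For colors $b_1,\dots,b_k$ and integers $n_i\ge0$, $\langle b_k^{n_k},\dots,b_1^{n_1}\rangle=\langle b_k^{n_k}\rangle\circ\cdots\circ\langle b_1^{n_1}\rangle$ (apply $\langle b_1^{n_1}\rangle$ first). $\mathcal{V}^m$ is the set of all $m$-vectors $\langle b_k^{n_k},\dots,b_1^{n_1}\rangle.\{\emptyset,\dots,\emptyset\}$ over all finite sequences of colors and nonnegative integers. Stackwise vectors: fix a linear extension $x_1<\dots<x_p$ of $P$ ($p=|P|$) with $a_t=\kappa(x_t)$. A $P$-partition bounded by $m$ is an order-reversing map $\psi:P\to\{0,1,\dots,m\}$ (equivalently an $m$-flag of order ideals $I_1\supseteq\cdots\supseteq I_m$, via $I_k=\{x:\psi(x)\ge k\}$). Its $m$-stackwise vector is $\langle a_p^{\psi(x_p)},\dots,a_1^{\psi(x_1)}\rangle.\{\emptyset,\dots,\emptyset\}$. *)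

theory Defs
  imports
    Complex_Main
    "HOL-Library.FuncSet"
    "HOL-Library.Multiset"
    "HOL-Library.Poly_Mapping"
    "Graph_Theory.Pair_Digraph"
begin

section \<open>Colored posets\<close>

text \<open>
  A finite poset is a finite subset \<open>P\<close> of a partially ordered type, with the induced order.
  Coverings, intervals and ideals are always taken relative to \<open>P\<close>, not to the ambient type.
  The colors are the vertices of a finite simple graph \<open>\<Gamma>\<close>, represented as a
  \<open>pair_graph\<close> (a finite symmetric loop-free digraph without parallel arcs).
\<close>

definition covers :: "'a::order set \<Rightarrow> 'a \<Rightarrow> 'a \<Rightarrow> bool" where
  "covers P x y \<longleftrightarrow> x \<in> P \<and> y \<in> P \<and> x < y \<and> \<not> (\<exists>z\<in>P. x < z \<and> z < y)"

definition connected_poset :: "'a::order set \<Rightarrow> bool" where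
  "connected_poset P \<longleftrightarrow> (\<forall>x\<in>P. \<forall>y\<in>P. equivclp (covers P) x y)"

definition adjacent :: "'c pair_pre_digraph \<Rightarrow> 'c \<Rightarrow> 'c \<Rightarrow> bool" where
  "adjacent \<Gamma> a b \<longleftrightarrow> (a, b) \<in> parcs \<Gamma>"

definition consecutive :: "'a::order set \<Rightarrow> ('a \<Rightarrow> 'c) \<Rightarrow> 'a \<Rightarrow> 'a \<Rightarrow> bool" where
  "consecutive P \<kappa> x y \<longleftrightarrow> x \<in> P \<and> y \<in> P \<and> \<kappa> x = \<kappa> y \<and> x < y \<and>
     \<not> (\<exists>z\<in>P. \<kappa> z = \<kappa> x \<and> x < z \<and> z < y)"

definition maximal_in_color :: "'a::order set \<Rightarrow> ('a \<Rightarrow> 'c) \<Rightarrow> 'a \<Rightarrow> bool" where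
  "maximal_in_color P \<kappa> x \<longleftrightarrow> x \<in> P \<and> \<not> (\<exists>y\<in>P. \<kappa> y = \<kappa> x \<and> x < y)"

definition minimal_in_color :: "'a::order set \<Rightarrow> ('a \<Rightarrow> 'c) \<Rightarrow> 'a \<Rightarrow> bool" where
  "minimal_in_color P \<kappa> x \<longleftrightarrow> x \<in> P \<and> \<not> (\<exists>y\<in>P. \<kappa> y = \<kappa> x \<and> y < x)"

locale colored_poset =
  fixes \<Gamma> :: "'c pair_pre_digraph" and P :: "'a::order set" and \<kappa> :: "'a \<Rightarrow> 'c"
  assumes graph: "pair_graph \<Gamma>"
    and finite_poset: "finite P"
    and color_surj: "\<kappa> ` P = pverts \<Gamma>"

locale colored_d_complete = colored_poset +
  assumes EC: "\<lbrakk>x \<in> P; y \<in> P; \<kappa> x = \<kappa> y\<rbrakk> \<Longrightarrow> x \<le> y \<or> y \<le> x"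
    and NA: "covers P x y \<Longrightarrow> adjacent \<Gamma> (\<kappa> x) (\<kappa> y)"
    and AC: "\<lbrakk>x \<in> P; y \<in> P; adjacent \<Gamma> (\<kappa> x) (\<kappa> y)\<rbrakk> \<Longrightarrow> x \<le> y \<or> y \<le> x"
    and ICE2: "consecutive P \<kappa> x y \<Longrightarrow>
      card {z \<in> P. x < z \<and> z < y \<and> adjacent \<Gamma> (\<kappa> x) (\<kappa> z)} = 2"
    and UCB1: "maximal_in_color P \<kappa> x \<Longrightarrow>
      card {y \<in> P. x < y \<and> adjacent \<Gamma> (\<kappa> x) (\<kappa> y)} \<le> 1"

locale colored_minuscule = colored_d_complete +
  assumes LCB1: "minimal_in_color P \<kappa> x \<Longrightarrow>
      card {y \<in> P. y < x \<and> adjacent \<Gamma> (\<kappa> x) (\<kappa> y)} \<le> 1"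


section \<open>Formal complex linear combinations\<close>

definition cscale :: "complex \<Rightarrow> ('k \<Rightarrow>\<^sub>0 complex) \<Rightarrow> ('k \<Rightarrow>\<^sub>0 complex)" where
  "cscale c v = Poly_Mapping.map ((*) c) v"

lemma lookup_cscale [simp]: "Poly_Mapping.lookup (cscale c v) k = c * Poly_Mapping.lookup v k"
  by (auto simp: cscale_def Poly_Mapping.map.rep_eq when_def)

interpretation formal: vector_space cscale
  by unfold_locales (auto intro!: poly_mapping_eqI simp: lookup_add algebra_simps)

definition lin_extend :: "('k \<Rightarrow> 'l \<Rightarrow>\<^sub>0 complex) \<Rightarrow> ('k \<Rightarrow>\<^sub>0 complex) \<Rightarrow> ('l \<Rightarrow>\<^sub>0 complex)" where
  "lin_extend f v = (\<Sum>k\<in>Poly_Mapping.keys v. cscale (Poly_Mapping.lookup v k) (f k))"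


section \<open>Color operators\<close>

text \<open>
  For \<open>I\<close> an ideal, the sum ranges over the minimal elements of \<open>P - I\<close> of color \<open>a\<close>.
\<close>

definition ideal_op :: "'a::order set \<Rightarrow> ('a \<Rightarrow> 'c) \<Rightarrow> 'c \<Rightarrow> 'a set \<Rightarrow> ('a set \<Rightarrow>\<^sub>0 complex)" where
  "ideal_op P \<kappa> a I =
     (\<Sum>x | x \<in> P - I \<and> \<kappa> x = a \<and> \<not> (\<exists>y\<in>P - I. y < x). Poly_Mapping.single (insert x I) 1)"

text \<open>
  On a multiset \<open>M = {I\<^sub>1, \<dots>, I\<^sub>m}\<close>, the \<open>j\<close>-th summand replaces one
  occurrence of \<open>I\<^sub>j\<close> by \<open>X\<^sub>a.I\<^sub>j\<close>; the outer sum counts multiplicities.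
\<close>

definition multi_op ::
    "'a::order set \<Rightarrow> ('a \<Rightarrow> 'c) \<Rightarrow> 'c \<Rightarrow> 'a set multiset \<Rightarrow> ('a set multiset \<Rightarrow>\<^sub>0 complex)" where
  "multi_op P \<kappa> a M =
     (\<Sum>I\<in>#M. lin_extend (\<lambda>J. Poly_Mapping.single (add_mset J (M - {#I#})) 1) (ideal_op P \<kappa> a I))"

definition color_op :: "'a::order set \<Rightarrow> ('a \<Rightarrow> 'c) \<Rightarrow> 'c \<Rightarrow>
    ('a set multiset \<Rightarrow>\<^sub>0 complex) \<Rightarrow> ('a set multiset \<Rightarrow>\<^sub>0 complex)" where
  "color_op P \<kappa> a = lin_extend (multi_op P \<kappa> a)"

definition divided_power :: "'a::order set \<Rightarrow> ('a \<Rightarrow> 'c) \<Rightarrow> 'c \<times> nat \<Rightarrow>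
    ('a set multiset \<Rightarrow>\<^sub>0 complex) \<Rightarrow> ('a set multiset \<Rightarrow>\<^sub>0 complex)" where
  "divided_power P \<kappa> = (\<lambda>(a, k) v. cscale (1 / fact k) ((color_op P \<kappa> a ^^ k) v))"

text \<open>
  Words \<open>[(b\<^sub>k, n\<^sub>k), \<dots>, (b\<^sub>1, n\<^sub>1)]\<close> are written in the order
  of composition: the last entry acts first.
\<close>

definition word_op :: "'a::order set \<Rightarrow> ('a \<Rightarrow> 'c) \<Rightarrow> ('c \<times> nat) list \<Rightarrow>
    ('a set multiset \<Rightarrow>\<^sub>0 complex) \<Rightarrow> ('a set multiset \<Rightarrow>\<^sub>0 complex)" where
  "word_op P \<kappa> w = foldr (divided_power P \<kappa>) w"

definition empty_ideals :: "nat \<Rightarrow> ('a set multiset \<Rightarrow>\<^sub>0 complex)" where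
  "empty_ideals m = Poly_Mapping.single (replicate_mset m {}) 1"

definition generated_vectors :: "'c pair_pre_digraph \<Rightarrow> 'a::order set \<Rightarrow> ('a \<Rightarrow> 'c) \<Rightarrow> nat \<Rightarrow>
    ('a set multiset \<Rightarrow>\<^sub>0 complex) set" where
  "generated_vectors \<Gamma> P \<kappa> m =
     {word_op P \<kappa> w (empty_ideals m) | w. fst ` set w \<subseteq> pverts \<Gamma>}"


section \<open>Stackwise vectors and standardness\<close>

definition linear_extension :: "'a::order set \<Rightarrow> 'a list \<Rightarrow> bool" where
  "linear_extension P xs \<longleftrightarrow> distinct xs \<and> set xs = P \<and>
     (\<forall>i<length xs. \<forall>j<length xs. xs ! i < xs ! j \<longrightarrow> i < j)"

text \<open>Taking extensional functions makes each \<open>P\<close>-partition occur exactly once.\<close>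

definition bounded_partitions :: "'a::order set \<Rightarrow> nat \<Rightarrow> ('a \<Rightarrow> nat) set" where
  "bounded_partitions P m = {\<psi> \<in> P \<rightarrow>\<^sub>E {0..m}. antimono_on P \<psi>}"

definition stackwise_vector :: "'a::order set \<Rightarrow> ('a \<Rightarrow> 'c) \<Rightarrow> 'a list \<Rightarrow> nat \<Rightarrow> ('a \<Rightarrow> nat) \<Rightarrow>
    ('a set multiset \<Rightarrow>\<^sub>0 complex)" where
  "stackwise_vector P \<kappa> xs m \<psi> =
     word_op P \<kappa> (rev (map (\<lambda>x. (\<kappa> x, \<psi> x)) xs)) (empty_ideals m)"

text \<open>
  The stackwise vectors are a family indexed by the \<open>P\<close>-partitions bounded by \<open>m\<close>; linear
  independence of the family includes that its members are pairwise distinct.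
\<close>

definition standard_poset :: "'c pair_pre_digraph \<Rightarrow> 'a::order set \<Rightarrow> ('a \<Rightarrow> 'c) \<Rightarrow> bool" where
  "standard_poset \<Gamma> P \<kappa> \<longleftrightarrow> (\<forall>m\<ge>1. \<forall>xs. linear_extension P xs \<longrightarrow>
     inj_on (stackwise_vector P \<kappa> xs m) (bounded_partitions P m) \<and>
     formal.independent (stackwise_vector P \<kappa> xs m ` bounded_partitions P m) \<and>
     (\<forall>v\<in>generated_vectors \<Gamma> P \<kappa> m. \<exists>c :: ('a \<Rightarrow> nat) \<Rightarrow> int.
        v = (\<Sum>\<psi>\<in>bounded_partitions P m. cscale (of_int (c \<psi>)) (stackwise_vector P \<kappa> xs m \<psi>))))"

end

theory Submission
  imports Defs "HOL-Combinatorics.Multiset_Permutations"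
begin

text \<open>
  Write \<open>V\<close> for the span of the order ideals. By EC and ICE2 every \<open>X\<^sub>a\<close> adds at most one
  element to an ideal and squares to zero on \<open>V\<close>, so on \<open>m\<close>-fold tensors \<open>\<langle>a\<^sup>k\<rangle>\<close> acts on the
  \<open>k\<close>-subsets of the factors, with integer coefficients. The coefficient of the stackwise vector of
  \<open>\<psi>\<close> at the flag of \<open>\<psi>\<close> is \<open>1\<close>, and all other tensors carrying a nonzero coefficient either
  have smaller total height or contain every element equally often. This triangularity gives linear
  independence, and it reduces the spanning statement, including integrality, to the claim that
  a vector of the module generated by \<open>\<emptyset> \<otimes> \<dots> \<otimes> \<emptyset>\<close> that vanishes on all flags is zero.

  A straightening argument reduces this claim to \<open>m = 2\<close>. There one replaces \<open>\<emptyset>\<close> by an ideal \<open>B\<close>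
  and inducts downwards on \<open>B\<close>, as in Demazure's character formula: for \<open>x\<close> minimal in \<open>P - B\<close> of
  color \<open>a\<close>, the operators of color \<open>a\<close> that add and remove elements span an \<open>sl\<^sub>2\<close> whose weights
  are well behaved on ideals above \<open>B\<close> (by ICE2 and UCB1), and the module generated by \<open>B \<otimes> B\<close>
  is contained in the closure of the module of \<open>B \<union> {x}\<close> under removal of elements of color \<open>a\<close>.
\<close>

text \<open>Two factors are the right size for the downward induction. There the weights of color
  \<open>a\<close> lie between -2 and 2, and only \<open>Y\<close> and its square are needed to pass
  from the module \<open>N\<close> of \<open>insert x B\<close> to an enlarged module
  \<open>M\<close> containing that of \<open>B\<close>. In weight at least 1, \<open>M\<close> has
  nothing outside \<open>N\<close>. Negative weights are carried to positive ones by X or X^2, which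
  are injective there and turn values at flags into values at flags. The real obstacle is weight 0,
  where X need not be injective; the vector is shown to lie in \<open>N\<close> by interpolating
  values on flags, so triangularity is used inside the injectivity proof as well as before it. The
  passage from m factors to two rests on slicing: fixing all but two neighboring factors of a vector
  of the cyclic module leaves a vector of the two-factor cyclic module. The induction runs downward
  because at B = P only one tensor is left, and because removing color \<open>a\<close> from ideals
  above \<open>insert x B\<close> yields ideals above \<open>B\<close>.\<close>

subsection \<open>Operators on coefficient functions\<close>

text \<open>
  A tensor is represented by its coefficient function, so operators appear transposed: if \<open>g\<close>
  removes an element of color \<open>a\<close>, then \<open>leib g\<close> is the action of \<open>X\<^sub>a\<close>.
\<close>

fun leib :: "('i \<Rightarrow> 'i option) \<Rightarrow> ('i list \<Rightarrow> complex) \<Rightarrow> 'i list \<Rightarrow> complex" where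
  "leib g u [] = 0"
| "leib g u (I # L) =
     (case g I of None \<Rightarrow> 0 | Some J \<Rightarrow> u (J # L)) + leib g (\<lambda>L. u (I # L)) L"

text \<open>The sum over all ways to apply \<open>g\<close> at \<open>k\<close> distinct positions.
  This form of the divided power has integer coefficients by construction.\<close>

fun dpow :: "('i \<Rightarrow> 'i option) \<Rightarrow> nat \<Rightarrow> ('i list \<Rightarrow> complex) \<Rightarrow> 'i list \<Rightarrow> complex" where
  "dpow g k u [] = (if k = 0 then u [] else 0)"
| "dpow g k u (I # L) = dpow g k (\<lambda>L. u (I # L)) L +
     (case g I of None \<Rightarrow> 0 | Some J \<Rightarrow> (case k of 0 \<Rightarrow> 0 | Suc l \<Rightarrow> dpow g l (\<lambda>L. u (J # L)) L))"

lemma leib_add: "leib g (\<lambda>L. u L + v L) L = leib g u L + leib g v L"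
  by (induction L arbitrary: u v) (auto split: option.split)

lemma leib_scale: "leib g (\<lambda>L. c * u L) L = c * leib g u L"
  by (induction L arbitrary: u) (auto simp: algebra_simps split: option.split)

lemma leib_zero [simp]: "leib g (\<lambda>L. 0) L = 0"
  using leib_scale[of g 0 "\<lambda>_. 0"] by simp

lemma leib_add': "leib g (\<lambda>L. u L + v L) = (\<lambda>L. leib g u L + leib g v L)"
  using leib_add by blast

lemma leib_scale': "leib g (\<lambda>L. c * u L) = (\<lambda>L. c * leib g u L)"
  using leib_scale by blast

lemma leib_zero': "leib g (\<lambda>L. 0) = (\<lambda>L. 0)"
  using leib_zero by blast

lemma dpow_zero: "dpow g k (\<lambda>L. 0) L = 0"
  by (induction L arbitrary: k) (auto split: option.split nat.split)

lemma leib_snoc: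
  "leib g u (L @ [I]) =
     leib g (\<lambda>L. u (L @ [I])) L + (case g I of None \<Rightarrow> 0 | Some J \<Rightarrow> u (L @ [J]))"
  by (induction L arbitrary: u) (auto split: option.split)

lemma leib_commute:
  assumes "\<And>I. Option.bind (g I) h = Option.bind (h I) g"
  shows "leib g (leib h u) L = leib h (leib g u) L"
proof (induction L arbitrary: u)
  case (Cons I L)
  have "(case g I of None \<Rightarrow> 0 | Some J \<Rightarrow> case h J of None \<Rightarrow> 0 | Some K \<Rightarrow> u (K # L)) =
    (case h I of None \<Rightarrow> 0 | Some J \<Rightarrow> case g J of None \<Rightarrow> 0 | Some K \<Rightarrow> u (K # L))"
    using assms[of I] by (cases "g I"; cases "h I") (auto split: option.splits)
  with Cons show ?case
    by (auto simp: leib_add split: option.splits)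
qed simp

section \<open>The sl2 attached to one color\<close>

definition wt :: "('i \<Rightarrow> 'i option) \<Rightarrow> ('i \<Rightarrow> 'i option) \<Rightarrow> 'i \<Rightarrow> int" where
  "wt g h I = of_bool (g I \<noteq> None) - of_bool (h I \<noteq> None)"

definition wts :: "('i \<Rightarrow> 'i option) \<Rightarrow> ('i \<Rightarrow> 'i option) \<Rightarrow> 'i list \<Rightarrow> int" where
  "wts g h L = sum_list (map (wt g h) L)"

lemma wts_simps [simp]: "wts g h [] = 0" "wts g h (I # L) = wt g h I + wts g h L"
  by (simp_all add: wts_def)

locale sl2_string =
  fixes g h :: "'i \<Rightarrow> 'i option"
  assumes inverse: "g I = Some J \<longleftrightarrow> h J = Some I"
    and nilpotent: "g I = Some J \<Longrightarrow> g J = None"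
begin

lemma nilpotent': "h I = Some J \<Longrightarrow> h J = None"
proof (rule ccontr)
  assume "h I = Some J" "h J \<noteq> None"
  then obtain K where "h J = Some K" by blast
  then have "g K = Some J" by (simp add: inverse)
  then have "g J = None" by (rule nilpotent)
  with \<open>h I = Some J\<close> show False by (simp flip: inverse)
qed

lemma exclusive: "g I = Some J \<Longrightarrow> h I = None" "h I = Some J \<Longrightarrow> g I = None"
  by (erule nilpotent'[OF inverse[THEN iffD1]], erule nilpotent[OF inverse[THEN iffD2]])

lemma wt_cases:
  "wt g h I = 1 \<longleftrightarrow> g I \<noteq> None" "wt g h I = -1 \<longleftrightarrow> h I \<noteq> None"
  "-1 \<le> wt g h I" "wt g h I \<le> 1"
  using exclusive[of I] by (cases "g I"; cases "h I"; simp add: wt_def)+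

text \<open>The relation [X, Y] = H. Terms that act on two different factors cancel, so only a
  single factor counts, and there \<open>g\<close> and \<open>h\<close> are mutually inverse partial
  maps.\<close>

lemma commutator:
  "leib g (leib h u) L = leib h (leib g u) L + of_int (wts g h L) * u L"
proof (induction L arbitrary: u)
  case (Cons I L)
  have "(case g I of None \<Rightarrow> 0 | Some J \<Rightarrow> case h J of None \<Rightarrow> 0 | Some K \<Rightarrow> u (K # L)) =
    (case h I of None \<Rightarrow> 0 | Some J \<Rightarrow> case g J of None \<Rightarrow> 0 | Some K \<Rightarrow> u (K # L))
      + of_int (wt g h I) * u (I # L)"
  proof (cases "g I")
    case (Some J)
    then have "h J = Some I" "h I = None" using inverse[of I J] exclusive(1)[of I J] by simp_all
    with Some show ?thesis by (simp add: wt_def)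
  next
    case None
    show ?thesis
    proof (cases "h I")
      case (Some K)
      then have "g K = Some I" using inverse[of K I] by simp
      with Some None show ?thesis by (simp add: wt_def)
    qed (simp add: None wt_def)
  qed
  with Cons show ?case
    by (auto simp: leib_add algebra_simps split: option.splits)
qed simp

text \<open>\<open>Y\<close> lowers weights by 2. With \<open>p\<close> arbitrary this covers both
  multiplication by the weight and projection onto a weight space.\<close>

lemma wts_leib_h:
  fixes p :: "int \<Rightarrow> complex"
  shows "p (wts g h L) * leib h u L = leib h (\<lambda>L. p (wts g h L - 2) * u L) L"
proof (induction L arbitrary: u p)
  case (Cons I L)
  have "wt g h J = 1" "wt g h I = -1" if "h I = Some J" for J
    using that exclusive(2)[of I J] nilpotent'[of I J] inverse[of J I] by (auto simp: wt_def)
  moreover have "p (wt g h I + wts g h L) * leib h (\<lambda>L. u (I # L)) L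
    = leib h (\<lambda>L. p (wt g h I + wts g h L - 2) * u (I # L)) L"
    using Cons[of "\<lambda>c. p (wt g h I + c)" "\<lambda>L. u (I # L)"] by (simp add: algebra_simps)
  ultimately show ?case
    by (auto simp: algebra_simps split: option.splits)
qed simp

text \<open>Since \<open>g\<close> never applies twice to the same factor, the k-th power runs over
  ordered choices of \<open>k\<close> distinct positions, and each set of positions arises in k!
  orders.\<close>

lemma dpow_power: "(leib g ^^ k) u L = fact k * dpow g k u L"
proof -
  have lin: "dpow g k (\<lambda>L. u L + v L) L = dpow g k u L + dpow g k v L" for k u v and L
    by (induction L arbitrary: k u v) (auto split: option.split nat.split)
  have step: "leib g (dpow g k u) L = of_nat (Suc k) * dpow g (Suc k) u L" for k u L
  proof (induction L arbitrary: k u)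
    case (Cons I L)
    show ?case
    proof (cases "g I")
      case None
      with Cons show ?thesis by simp
    next
      case (Some J)
      with nilpotent have "g J = None" by simp
      with Some Cons show ?thesis
        by (cases k) (auto simp: leib_add lin dpow_zero algebra_simps)
    qed
  qed simp
  have z0: "dpow g 0 u L = u L" for u and L
    by (induction L arbitrary: u) (auto split: option.split)
  show ?thesis
  proof (induction k arbitrary: L)
    case 0
    show ?case by (simp add: z0)
  next
    case (Suc k)
    then have "(leib g ^^ k) u = (\<lambda>L. fact k * dpow g k u L)" by blast
    then show ?case by (simp add: leib_scale step algebra_simps)
  qed
qed

end

lemma dpow_Ints: "(\<And>L. u L \<in> \<int>) \<Longrightarrow> dpow g k u L \<in> \<int>"
  by (induction L arbitrary: k u) (auto split: option.split nat.split)

section \<open>Cyclic modules generated by one tensor\<close>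

inductive_set cyclic :: "('c \<Rightarrow> 'i \<Rightarrow> 'i option) \<Rightarrow> 'i list \<Rightarrow> ('i list \<Rightarrow> complex) set"
  for G :: "'c \<Rightarrow> 'i \<Rightarrow> 'i option" and L\<^sub>0 :: "'i list" where
  base: "(\<lambda>L. of_bool (L = L\<^sub>0)) \<in> cyclic G L\<^sub>0"
| add: "u \<in> cyclic G L\<^sub>0 \<Longrightarrow> v \<in> cyclic G L\<^sub>0 \<Longrightarrow> (\<lambda>L. u L + v L) \<in> cyclic G L\<^sub>0"
| scale: "u \<in> cyclic G L\<^sub>0 \<Longrightarrow> (\<lambda>L. c * u L) \<in> cyclic G L\<^sub>0"
| leib: "u \<in> cyclic G L\<^sub>0 \<Longrightarrow> leib (G b) u \<in> cyclic G L\<^sub>0"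

lemma cyclic_zero: "(\<lambda>L. 0) \<in> cyclic G L\<^sub>0"
  using cyclic.scale[OF cyclic.base, of 0] by simp

lemma cyclic_diff: "u \<in> cyclic G L\<^sub>0 \<Longrightarrow> v \<in> cyclic G L\<^sub>0 \<Longrightarrow> (\<lambda>L. u L - v L) \<in> cyclic G L\<^sub>0"
  using cyclic.add[OF _ cyclic.scale[of v G L\<^sub>0 "-1"]] by simp

lemma cyclic_sum:
  "(\<And>i. i \<in> A \<Longrightarrow> u i \<in> cyclic G L\<^sub>0) \<Longrightarrow> (\<lambda>L. \<Sum>i\<in>A. u i L) \<in> cyclic G L\<^sub>0"
  by (induction A rule: infinite_finite_induct) (auto intro: cyclic_zero cyclic.add)

text \<open>Slicing \<open>leib g u\<close> at first factor \<open>I\<close> gives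
  \<open>leib g\<close> of the slice of \<open>u\<close> at \<open>I\<close>, plus the slice at
  \<open>J\<close> if \<open>g\<close> lowers \<open>I\<close> to \<open>J\<close>. Hence slices
  stay in the cyclic module with one factor fewer. Doing this from both ends yields
  \<open>cyclic_infix\<close>.\<close>

lemma cyclic_Cons:
  "u \<in> cyclic G (replicate (Suc n) B) \<Longrightarrow> (\<lambda>L. u (I # L)) \<in> cyclic G (replicate n B)"
proof (induction arbitrary: I rule: cyclic.induct)
  case base
  show ?case
    by (cases "I = B") (auto intro: cyclic.base cyclic_zero)
next
  case (leib u b)
  then show ?case
    using cyclic.add[OF leib.IH cyclic.leib[OF leib.IH]] cyclic.leib[OF leib.IH]
    by (cases "G b I") simp_all
qed (auto intro: cyclic.intros)

lemma cyclic_snoc: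
  "u \<in> cyclic G (replicate (Suc n) B) \<Longrightarrow> (\<lambda>L. u (L @ [I])) \<in> cyclic G (replicate n B)"
proof (induction arbitrary: I rule: cyclic.induct)
  case base
  have "L @ [I] = replicate (Suc n) B \<longleftrightarrow> I = B \<and> L = replicate n B" for L
    by (simp add: replicate_append_same[symmetric] conj_commute)
  then show ?case
    by (cases "I = B") (auto intro: cyclic.base cyclic_zero)
next
  case (leib u b)
  then show ?case
    using cyclic.add[OF cyclic.leib[OF leib.IH] leib.IH] cyclic.leib[OF leib.IH]
    by (cases "G b I") (simp_all add: leib_snoc)
qed (auto intro: cyclic.intros)

lemma cyclic_append_left:
  "u \<in> cyclic G (replicate (length A + n) B) \<Longrightarrow> (\<lambda>L. u (A @ L)) \<in> cyclic G (replicate n B)"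
proof (induction A arbitrary: u)
  case (Cons I A)
  then show ?case using Cons.IH[OF cyclic_Cons[of u G "length A + n" B I]] by simp
qed simp

lemma cyclic_append_right:
  "u \<in> cyclic G (replicate (n + length C) B) \<Longrightarrow> (\<lambda>L. u (L @ C)) \<in> cyclic G (replicate n B)"
proof (induction C arbitrary: u rule: rev_induct)
  case (snoc I C)
  then show ?case using snoc.IH[OF cyclic_snoc[of u G "n + length C" B I]] by simp
qed simp

lemma cyclic_infix:
  assumes "u \<in> cyclic G (replicate (length A + n + length C) B)"
  shows "(\<lambda>L. u (A @ L @ C)) \<in> cyclic G (replicate n B)"
  using cyclic_append_right[OF cyclic_append_left[of u G A "n + length C" B]] assms
  by (simp add: add.assoc)

lemma leib_support:
  assumes "leib g u L \<noteq> 0"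
  obtains A I J C where "L = A @ I # C" "g I = Some J" "u (A @ J # C) \<noteq> 0"
  using assms
proof (induction L arbitrary: u thesis)
  case (Cons I L)
  show ?case
  proof (cases "leib g (\<lambda>L. u (I # L)) L = 0")
    case True
    with Cons.prems show ?thesis
      by (cases "g I") (auto intro: Cons.prems(1)[of "[]"])
  next
    case False
    show ?thesis
      by (rule Cons.IH[OF _ False]) (metis Cons.prems(1) append_Cons)
  qed
qed simp

lemma leib_length:
  assumes "\<And>L. u L \<noteq> 0 \<Longrightarrow> length L = m" "leib g u L \<noteq> 0"
  shows "length L = m"
  using leib_support[OF assms(2)] assms(1) by (metis length_append length_Cons)

text \<open>No factor can be lowered twice, so both are lowered once; the 2 counts the two
  orders.\<close>

lemma leib_leib_pair:
  assumes "\<And>I J. g I = Some J \<Longrightarrow> g J = None"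
  shows "leib g (leib g u) [I, J] =
    2 * (case g I of None \<Rightarrow> 0 | Some I' \<Rightarrow> case g J of None \<Rightarrow> 0 | Some J' \<Rightarrow> u [I', J'])"
  using assms[of I] assms[of J] by (cases "g I"; cases "g J") auto

lemma cyclic_support:
  assumes "u \<in> cyclic G (replicate m B)" "u L \<noteq> 0"
    and "S B" and S: "\<And>b I J. G b I = Some J \<Longrightarrow> S J \<Longrightarrow> S I"
  shows "length L = m \<and> (\<forall>I\<in>set L. S I)"
  using assms(1,2)
proof (induction arbitrary: L rule: cyclic.induct)
  case (leib u b)
  from leib.prems obtain A I J C where "L = A @ I # C" "G b I = Some J" "u (A @ J # C) \<noteq> 0"
    by (rule leib_support)
  with leib.IH[of "A @ J # C"] S show ?case by auto
qed (use \<open>S B\<close> in \<open>force+\<close>)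

lemma leib_weight:
  fixes p :: "int \<Rightarrow> complex"
  assumes "\<And>L. u L \<noteq> 0 \<Longrightarrow> \<forall>I\<in>set L. S I"
    and "\<And>I J. d I = Some J \<Longrightarrow> S J \<Longrightarrow> wt g h I = wt g h J + s"
  shows "p (wts g h L) * leib d u L = leib d (\<lambda>L. p (wts g h L + s) * u L) L"
  using assms(1)
proof (induction L arbitrary: u p)
  case (Cons I L)
  have "p (wt g h I + wts g h L) * u (J # L) = p (wt g h J + wts g h L + s) * u (J # L)"
    if "d I = Some J" for J
    using Cons.prems[of "J # L"] assms(2)[OF that]
    by (cases "u (J # L) = 0") (auto simp: algebra_simps)
  moreover have "p (wt g h I + wts g h L) * leib d (\<lambda>L. u (I # L)) L
    = leib d (\<lambda>L. p (wt g h I + wts g h L + s) * u (I # L)) L"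
    using Cons.IH[of "\<lambda>L. u (I # L)" "\<lambda>c. p (wt g h I + c)"] Cons.prems
    by (force simp: algebra_simps)
  ultimately show ?case
    by (auto simp: algebra_simps split: option.splits)
qed simp

text \<open>The generator has a single weight and each operator shifts all weights by an amount
  depending only on its color, so functions of the weight preserve the module. Uniform shifts are
  demanded only on \<open>S\<close>, which contains every ideal occurring in the support.\<close>

lemma cyclic_weight:
  fixes p :: "int \<Rightarrow> complex"
  assumes "u \<in> cyclic G (replicate m B)"
    and "S B" and S: "\<And>b I J. G b I = Some J \<Longrightarrow> S J \<Longrightarrow> S I"
    and shift: "\<And>b I J. G b I = Some J \<Longrightarrow> S J \<Longrightarrow> wt g h I = wt g h J + s b"
  shows "(\<lambda>L. p (wts g h L) * u L) \<in> cyclic G (replicate m B)"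
  using assms(1)
proof (induction arbitrary: p rule: cyclic.induct)
  case base
  have "(\<lambda>L. p (wts g h L) * of_bool (L = replicate m B)) =
    (\<lambda>L. p (wts g h (replicate m B)) * of_bool (L = replicate m B))" by auto
  then show ?case using cyclic.scale[OF cyclic.base] by metis
next
  case (leib u b)
  have "p (wts g h L) * leib (G b) u L = leib (G b) (\<lambda>L. p (wts g h L + s b) * u L) L" for L
  proof (rule leib_weight[where S = S])
    show "\<forall>I\<in>set L. S I" if "u L \<noteq> 0" for L
      using cyclic_support[where S = S, OF leib.hyps that \<open>S B\<close>] S by blast
  qed (rule shift)
  then have "(\<lambda>L. p (wts g h L) * leib (G b) u L) =
    leib (G b) (\<lambda>L. p (wts g h L + s b) * u L)" by blast
  then show ?case using cyclic.leib[OF leib.IH[of "\<lambda>c. p (c + s b)"]] by simp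
next
  case (scale u c)
  then show ?case using cyclic.scale[OF scale.IH, of c] by (simp add: mult.left_commute)
qed (auto simp: distrib_left intro: cyclic.intros)

section \<open>Unitriangular systems\<close>

lemma triangular_solve:
  fixes c :: "'f \<Rightarrow> 'f \<Rightarrow> complex" and r :: "'f \<Rightarrow> nat"
  assumes "finite A" "\<And>x. x \<in> A \<Longrightarrow> c x x = 1"
    and "\<And>x y. x \<in> A \<Longrightarrow> y \<in> A \<Longrightarrow> c x y \<noteq> 0 \<Longrightarrow> x \<noteq> y \<Longrightarrow> r y < r x"
  shows "\<exists>d. (\<forall>y\<in>A. (\<Sum>x\<in>A. d x * c x y) = t y) \<and>
    ((\<forall>x\<in>A. t x \<in> \<int>) \<and> (\<forall>x\<in>A. \<forall>y\<in>A. c x y \<in> \<int>) \<longrightarrow> (\<forall>x\<in>A. d x \<in> \<int>))"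
  using assms
proof (induction A arbitrary: t rule: finite_ranking_induct[where f = r])
  case (insert z S)
  show ?case
  proof (cases "z \<in> S")
    case True
    with insert show ?thesis by (simp add: insert_absorb)
  next
    case False
    obtain d where d: "\<forall>y\<in>S. (\<Sum>x\<in>S. d x * c x y) = t y - t z * c z y"
      "(\<forall>x\<in>S. t x - t z * c z x \<in> \<int>) \<and> (\<forall>x\<in>S. \<forall>y\<in>S. c x y \<in> \<int>) \<longrightarrow> (\<forall>x\<in>S. d x \<in> \<int>)"
      using insert.IH[of "\<lambda>y. t y - t z * c z y"] insert.prems by auto
    \<comment> \<open>As \<open>z\<close> has the largest rank, its column is zero off the diagonal,
      so its coefficient must be \<open>t z\<close>. No division takes place, which preserves
      integrality.\<close>
    let ?d = "d(z := t z)"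
    have *: "(\<Sum>x\<in>insert z S. ?d x * c x y) = t z * c z y + (\<Sum>x\<in>S. d x * c x y)" for y
      using insert.hyps False by (auto intro!: sum.cong)
    have "c x z = 0" if "x \<in> S" for x
      using that insert.hyps(2)[of x] insert.prems(2)[of x z] False by fastforce
    then have "(\<Sum>x\<in>S. d x * c x z) = 0" by simp
    then have "\<forall>y\<in>insert z S. (\<Sum>x\<in>insert z S. ?d x * c x y) = t y"
      using d(1) insert.prems(1)[of z] * by auto
    moreover have "(\<forall>x\<in>insert z S. t x \<in> \<int>) \<and> (\<forall>x\<in>insert z S. \<forall>y\<in>insert z S. c x y \<in> \<int>)
      \<longrightarrow> (\<forall>x\<in>insert z S. ?d x \<in> \<int>)"
      using d(2) by auto
    ultimately show ?thesis by blast
  qed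
qed simp

text \<open>Take an index of largest rank among those with nonzero coefficient: in its own column
  only the diagonal term survives.\<close>

lemma triangular_independent:
  fixes c :: "'f \<Rightarrow> 'f \<Rightarrow> complex" and r :: "'f \<Rightarrow> nat"
  assumes "finite A" "\<And>x. x \<in> A \<Longrightarrow> c x x = 1"
    and "\<And>x y. x \<in> A \<Longrightarrow> y \<in> A \<Longrightarrow> c x y \<noteq> 0 \<Longrightarrow> x \<noteq> y \<Longrightarrow> r y < r x"
    and "\<And>y. y \<in> A \<Longrightarrow> (\<Sum>x\<in>A. d x * c x y) = 0" and "z \<in> A"
  shows "d z = 0"
proof (rule ccontr)
  assume "d z \<noteq> 0"
  define D where "D = {x\<in>A. d x \<noteq> 0}"
  have "finite D" "D \<noteq> {}" using assms \<open>d z \<noteq> 0\<close> by (auto simp: D_def)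
  then have "Max (r ` D) \<in> r ` D" by (intro Max_in) auto
  then obtain y where "y \<in> D" "r y = Max (r ` D)" by auto
  with \<open>finite D\<close> have y: "y \<in> D" "\<And>x. x \<in> D \<Longrightarrow> r x \<le> r y" by auto
  have "(\<Sum>x\<in>A. d x * c x y) = (\<Sum>x\<in>A. if x = y then d y else 0)"
  proof (rule sum.cong)
    fix x assume "x \<in> A"
    have "y \<in> A" using y by (simp add: D_def)
    show "d x * c x y = (if x = y then d y else 0)"
    proof (cases "x = y \<or> d x = 0")
      case False
      then have "r x \<le> r y" using y(2)[of x] \<open>x \<in> A\<close> by (simp add: D_def)
      with assms(3)[OF \<open>x \<in> A\<close> \<open>y \<in> A\<close>] False show ?thesis by fastforce
    qed (use assms(2) \<open>y \<in> A\<close> in auto)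
  qed simp
  also have "\<dots> = d y" using assms(1) y(1) by (simp add: D_def)
  finally show False using assms(4)[of y] y(1) by (simp add: D_def)
qed

subsection \<open>Colored order ideals\<close>

text \<open>The only purpose of this locale is to fix the names of the type variables.\<close>

locale d_complete_poset = colored_d_complete \<Gamma> P \<kappa>
  for \<Gamma> :: "'c pair_pre_digraph" and P :: "'a::order set" and \<kappa> :: "'a \<Rightarrow> 'c"
begin

definition order_ideal :: "'a set \<Rightarrow> bool" where
  "order_ideal I \<longleftrightarrow> I \<subseteq> P \<and> (\<forall>x\<in>I. \<forall>y\<in>P. y \<le> x \<longrightarrow> y \<in> I)"

definition step :: "'c \<Rightarrow> 'a set \<Rightarrow> 'a set \<Rightarrow> bool" where
  "step a J I \<longleftrightarrow> order_ideal J \<and> order_ideal I \<and> (\<exists>x. x \<notin> J \<and> \<kappa> x = a \<and> I = insert x J)"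

definition down :: "'c \<Rightarrow> 'a set \<Rightarrow> 'a set option" where
  "down a I = (if \<exists>J. step a J I then Some (THE J. step a J I) else None)"

definition up :: "'c \<Rightarrow> 'a set \<Rightarrow> 'a set option" where
  "up a I = (if \<exists>K. step a I K then Some (THE K. step a I K) else None)"

lemma order_idealD: "order_ideal I \<Longrightarrow> x \<in> I \<Longrightarrow> y \<in> P \<Longrightarrow> y \<le> x \<Longrightarrow> y \<in> I"
  by (auto simp: order_ideal_def)

lemma order_idealD': "order_ideal I \<Longrightarrow> x \<in> I \<Longrightarrow> y \<in> P \<Longrightarrow> y < x \<Longrightarrow> y \<in> I"
  using order_idealD less_imp_le by blast

lemma order_ideal_subset: "order_ideal I \<Longrightarrow> I \<subseteq> P"
  by (auto simp: order_ideal_def)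

lemma order_ideal_finite: "order_ideal I \<Longrightarrow> finite I"
  using finite_poset finite_subset order_ideal_subset by blast

lemma order_ideal_Un: "order_ideal I \<Longrightarrow> order_ideal J \<Longrightarrow> order_ideal (I \<union> J)"
  by (auto simp: order_ideal_def)

lemma order_ideal_Int: "order_ideal I \<Longrightarrow> order_ideal J \<Longrightarrow> order_ideal (I \<inter> J)"
  by (auto simp: order_ideal_def)

lemma color_cases:
  assumes "x \<in> P" "y \<in> P" "\<kappa> x = \<kappa> y"
  obtains "x = y" | "x < y" | "y < x"
  using EC[OF assms] by (metis order_le_less)

text \<open>By EC two candidates for removal would be comparable. Removing the smaller one would
  leave a set that still contains the larger, which is not an ideal.\<close>

lemma step_unique_lower: "step a J I \<Longrightarrow> step a J' I \<Longrightarrow> J = J'"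
proof -
  assume *: "step a J I" "step a J' I"
  then obtain x x' where x: "x \<notin> J" "\<kappa> x = a" "I = insert x J" "x' \<notin> J'" "\<kappa> x' = a" "I = insert x' J'"
    and I: "order_ideal J" "order_ideal J'" "order_ideal I"
    by (auto simp: step_def)
  have P: "x \<in> P" "x' \<in> P" "\<kappa> x = \<kappa> x'" using x order_ideal_subset[OF I(3)] by auto
  then have "x = x'"
  proof (cases rule: color_cases)
    case 2
    have "x' \<in> insert x J" using x by auto
    with 2 show ?thesis using x I(1) P order_idealD'[of J x' x] by auto
  next
    case 3
    then show ?thesis using x I(2) P order_idealD'[of J' x x'] by auto
  qed (use x in auto)
  with x show "J = J'" by auto
qed

lemma step_unique_upper: "step a J I \<Longrightarrow> step a J I' \<Longrightarrow> I = I'"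
proof -
  assume *: "step a J I" "step a J I'"
  then obtain x x' where x: "x \<notin> J" "\<kappa> x = a" "I = insert x J" "x' \<notin> J" "\<kappa> x' = a" "I' = insert x' J"
    and I: "order_ideal I'" "order_ideal I"
    by (auto simp: step_def)
  have P: "x \<in> P" "x' \<in> P" "\<kappa> x = \<kappa> x'"
    using x order_ideal_subset[OF I(1)] order_ideal_subset[OF I(2)] by auto
  then have "x = x'"
  proof (cases rule: color_cases)
    case 2
    then show ?thesis using x I P order_idealD'[of I' x' x] by auto
  next
    case 3
    then show ?thesis using x I P order_idealD'[of I x x'] by auto
  qed (use x in auto)
  with x show "I = I'" by auto
qed

lemma down_eq_Some: "down a I = Some J \<longleftrightarrow> step a J I"
proof -
  have the: "(THE J. step a J I) = J" if "step a J I" for J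
    using that by (rule the_equality) (rule step_unique_lower[OF _ that])
  then show ?thesis unfolding down_def by (metis option.distinct(1) option.inject)
qed

lemma up_eq_Some: "up a J = Some I \<longleftrightarrow> step a J I"
proof -
  have the: "(THE I. step a J I) = I" if "step a J I" for I
    using that by (rule the_equality) (rule step_unique_upper[OF _ that])
  then show ?thesis unfolding up_def by (metis option.distinct(1) option.inject)
qed

text \<open>If \<open>x\<close> and then \<open>y\<close> of the same color could be added in
  succession, nothing of \<open>P\<close> would lie between them: such an element would belong to
  the ideal \<open>J\<close> while lying above \<open>x\<close>, which is not in \<open>J\<close>.
  But ICE2 puts two elements there.\<close>

lemma step_exclusive:
  assumes "step a J I" "step a I K" shows False
proof -
  obtain x y where x: "x \<notin> J" "\<kappa> x = a" "I = insert x J" and y: "y \<notin> I" "\<kappa> y = a" "K = insert y I"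
    and I: "order_ideal J" "order_ideal I" "order_ideal K"
    using assms by (auto simp: step_def)
  have P: "x \<in> P" "y \<in> P" "\<kappa> x = \<kappa> y" using x y order_ideal_subset[OF I(3)] by auto
  have below: "w \<notin> P" if "x < w" "w < y" for w
  proof
    assume "w \<in> P"
    then have "w \<in> J" using that order_idealD'[of K y w] x y I by auto
    then show False using order_idealD'[of J w x] that x P I by auto
  qed
  have "x < y"
    using P
  proof (cases rule: color_cases)
    case 3
    then show ?thesis using order_idealD'[of I x y] x y P I by auto
  qed (use x y in auto)
  then have "consecutive P \<kappa> x y"
    using P x y below by (auto simp: consecutive_def)
  from ICE2[OF this] have "{z \<in> P. x < z \<and> z < y \<and> adjacent \<Gamma> (\<kappa> x) (\<kappa> z)} \<noteq> {}"
    by force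
  with below show False by auto
qed

sublocale string: sl2_string "down a" "up a" for a
proof
  show "down a I = Some J \<longleftrightarrow> up a J = Some I" for I J
    by (simp add: down_eq_Some up_eq_Some)
  show "down a J = None" if "down a I = Some J" for I J
    using that step_exclusive by (cases "down a J") (auto simp: down_eq_Some)
qed

text \<open>The ideals form a square in which \<open>I\<close> and \<open>L\<close> are opposite
  corners; the missing corner is their union or intersection. Different colors guarantee that the
  two elements involved differ.\<close>

lemma step_commute:
  assumes "a \<noteq> b"
  shows "(\<exists>K. step b K I \<and> step a K L) \<longleftrightarrow> (\<exists>M. step a I M \<and> step b L M)"
proof safe
  fix K assume "step b K I" "step a K L"
  then obtain x y where x: "x \<notin> K" "\<kappa> x = b" "I = insert x K" and y: "y \<notin> K" "\<kappa> y = a" "L = insert y K"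
    and I: "order_ideal K" "order_ideal I" "order_ideal L"
    by (auto simp: step_def)
  have "I \<union> L = insert y I" "I \<union> L = insert x L" using x y by auto
  moreover have "y \<notin> I" "x \<notin> L" using x y assms by auto
  ultimately have "step a I (I \<union> L)" "step b L (I \<union> L)"
    using order_ideal_Un[OF I(2,3)] I x y unfolding step_def by metis+
  then show "\<exists>M. step a I M \<and> step b L M" by blast
next
  fix M assume "step a I M" "step b L M"
  then obtain x y where x: "x \<notin> I" "\<kappa> x = a" "M = insert x I" and y: "y \<notin> L" "\<kappa> y = b" "M = insert y L"
    and I: "order_ideal M" "order_ideal I" "order_ideal L"
    by (auto simp: step_def)
  have ne: "x \<noteq> y" using x y assms by auto
  have eq: "insert x I = insert y L" using x y by simp
  with ne have "y \<in> I" "x \<in> L" by auto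
  then have "I = insert y (I \<inter> L)" "L = insert x (I \<inter> L)"
    using eq x(1) y(1) by auto
  moreover have "y \<notin> I \<inter> L" "x \<notin> I \<inter> L" using x y by auto
  ultimately have "step b (I \<inter> L) I" "step a (I \<inter> L) L"
    using order_ideal_Int[OF I(2,3)] I x(2) y(2) unfolding step_def by blast+
  then show "\<exists>K. step b K I \<and> step a K L" by blast
qed

lemma leib_down_up_commute:
  assumes "a \<noteq> b"
  shows "leib (down b) (leib (up a) u) L = leib (up a) (leib (down b) u) L"
proof (rule leib_commute)
  fix I
  have "Option.bind (down b I) (up a) = Some K \<longleftrightarrow> Option.bind (up a I) (down b) = Some K" for K
    using step_commute[OF assms, of I K] by (auto simp: bind_eq_Some_conv down_eq_Some up_eq_Some)
  then show "Option.bind (down b I) (up a) = Option.bind (up a I) (down b)"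
    by (cases "Option.bind (up a I) (down b)") (simp, metis not_None_eq, simp)
qed

lemma removable_iff:
  assumes "order_ideal I"
  shows "down a I \<noteq> None \<longleftrightarrow> (\<exists>z\<in>I. \<kappa> z = a \<and> (\<forall>w\<in>I. \<not> z < w))"
proof -
  have "step a (I - {z}) I" if "z \<in> I" "\<kappa> z = a" "\<forall>w\<in>I. \<not> z < w" for z
    unfolding step_def
  proof (intro conjI exI)
    show "order_ideal (I - {z})"
      using assms that unfolding order_ideal_def by (auto simp: order_le_less)
  qed (use assms that in auto)
  moreover have "\<exists>z\<in>I. \<kappa> z = a \<and> (\<forall>w\<in>I. \<not> z < w)" if "step a J I" for J
  proof -
    from that obtain x where x: "x \<notin> J" "\<kappa> x = a" "I = insert x J" and J: "order_ideal J"
      by (auto simp: step_def)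
    have "\<not> x < w" if "w \<in> I" for w
      using that x order_idealD'[OF J, of w x] order_ideal_subset[OF assms] by auto
    with x show ?thesis by auto
  qed
  moreover have "down a I \<noteq> None \<longleftrightarrow> (\<exists>J. step a J I)" by (simp flip: down_eq_Some)
  ultimately show ?thesis by blast
qed

lemma addable_iff:
  assumes "order_ideal I"
  shows "up a I \<noteq> None \<longleftrightarrow> (\<exists>z\<in>P - I. \<kappa> z = a \<and> (\<forall>w\<in>P. w < z \<longrightarrow> w \<in> I))"
proof -
  have "step a I (insert z I)" if "z \<in> P - I" "\<kappa> z = a" "\<forall>w\<in>P. w < z \<longrightarrow> w \<in> I" for z
    unfolding step_def
  proof (intro conjI exI)
    show "order_ideal (insert z I)"
      using assms that unfolding order_ideal_def by (auto simp: order_le_less)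
  qed (use assms that in auto)
  moreover have "\<exists>z\<in>P - I. \<kappa> z = a \<and> (\<forall>w\<in>P. w < z \<longrightarrow> w \<in> I)" if "step a I J" for J
  proof -
    from that obtain x where x: "x \<notin> I" "\<kappa> x = a" "J = insert x I" and J: "order_ideal J"
      by (auto simp: step_def)
    then have "x \<in> P" using order_ideal_subset by blast
    moreover have "w \<in> I" if "w \<in> P" "w < x" for w
      using that x order_idealD'[OF J, of x w] by auto
    ultimately show ?thesis using x by auto
  qed
  moreover have "up a I \<noteq> None \<longleftrightarrow> (\<exists>J. step a I J)" by (simp flip: up_eq_Some)
  ultimately show ?thesis by blast
qed

lemma upper_cover_below:
  assumes "x \<in> P" "y \<in> P" "x < y"
  obtains c where "covers P x c" "c \<le> y"
proof -
  have "finite {z\<in>P. x < z \<and> z \<le> y}" "{z\<in>P. x < z \<and> z \<le> y} \<noteq> {}"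
    using finite_poset assms by auto
  from finite_has_minimal[OF this] obtain c
    where c: "c \<in> P" "x < c" "c \<le> y" "\<And>z. z \<in> P \<Longrightarrow> x < z \<Longrightarrow> z \<le> y \<Longrightarrow> z \<le> c \<Longrightarrow> c = z"
    by auto
  have "\<not> (x < z \<and> z < c)" if "z \<in> P" for z
    using c(4)[of z] that order.trans[of z c y] \<open>c \<le> y\<close> by (auto dest: less_imp_le)
  with c assms have "covers P x c" unfolding covers_def by blast
  with c that show ?thesis by blast
qed

lemma lower_cover_above:
  assumes "x \<in> P" "y \<in> P" "x < y"
  obtains c where "covers P c y" "x \<le> c"
proof -
  have "finite {z\<in>P. x \<le> z \<and> z < y}" "{z\<in>P. x \<le> z \<and> z < y} \<noteq> {}"
    using finite_poset assms by auto
  from finite_has_maximal[OF this] obtain c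
    where c: "c \<in> P" "x \<le> c" "c < y" "\<And>z. z \<in> P \<Longrightarrow> x \<le> z \<Longrightarrow> z < y \<Longrightarrow> c \<le> z \<Longrightarrow> c = z"
    by auto
  have "\<not> (c < z \<and> z < y)" if "z \<in> P" for z
    using c(4)[of z] that order.trans[of x c z] \<open>x \<le> c\<close> by (auto dest: less_imp_le)
  with c assms have "covers P c y" unfolding covers_def by blast
  with c that show ?thesis by blast
qed

lemma adjacent_sym: "adjacent \<Gamma> a b \<Longrightarrow> adjacent \<Gamma> b a"
proof -
  interpret pair_graph \<Gamma> by (rule graph)
  show "adjacent \<Gamma> a b \<Longrightarrow> adjacent \<Gamma> b a"
    unfolding adjacent_def by (rule arcs_symmetric)
qed

lemma adjacent_irrefl: "\<not> adjacent \<Gamma> a a"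
proof -
  interpret pair_graph \<Gamma> by (rule graph)
  show ?thesis using pair_no_loops unfolding adjacent_def by fastforce
qed

text \<open>An entry of the simply laced generalized Cartan matrix with diagram
  \<open>\<Gamma>\<close>.\<close>

definition shift :: "'c \<Rightarrow> 'c \<Rightarrow> int" where
  "shift a b = (if b = a then 2 else if adjacent \<Gamma> a b then -1 else 0)"

text \<open>
  Below the lowest element of color \<open>a\<close> the weights of color \<open>a\<close> do not shift uniformly unless
  LCB1 holds. Restricting to ideals above \<open>B\<close> avoids this: if \<open>x\<close> is missing, no element of
  a color adjacent to \<open>a\<close> can be added.
\<close>

lemma wt_shift:
  assumes "order_ideal B" "x \<in> P - B" "order_ideal (insert x B)" "B \<subseteq> I"
    and "step b I J" and a: "a = \<kappa> x"
  shows "wt (down a) (up a) J = wt (down a) (up a) I + shift a b"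
proof -
  obtain y where y: "y \<notin> I" "\<kappa> y = b" "J = insert y I" and I: "order_ideal I" and J: "order_ideal J"
    using assms(5) by (auto simp: step_def)
  have "y \<in> P" using y J order_ideal_subset by blast
  have IP: "I \<subseteq> P" using I by (rule order_ideal_subset)
  have below_y: "w \<in> I" if "w \<in> P" "w < y" for w
    using that order_idealD'[OF J, of y w] y by auto
  have above_y: "\<not> y \<le> w" if "w \<in> I" for w
    using that order_idealD[OF I, of w y] y \<open>y \<in> P\<close> by auto
  consider "b = a" | "b \<noteq> a" "\<not> adjacent \<Gamma> a b" | "b \<noteq> a" "adjacent \<Gamma> a b" by blast
  then show ?thesis
  proof cases
    case 1
    then have "down a J = Some I" "up a I = Some J"
      using assms(5) by (simp_all add: down_eq_Some up_eq_Some)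
    then show ?thesis
      using string.exclusive[of a] 1 by (simp add: wt_def shift_def)
  next
    case 2
    have "down a I \<noteq> None \<longleftrightarrow> down a J \<noteq> None"
    proof -
      have "\<not> z < y" if z: "z \<in> I" "\<kappa> z = a" "\<forall>w\<in>I. \<not> z < w" for z
      proof
        assume "z < y"
        then obtain c where "covers P z c" "c \<le> y" using upper_cover_below IP z \<open>y \<in> P\<close> by blast
        then have "c = y" using below_y z unfolding covers_def by (auto simp: order_le_less)
        with \<open>covers P z c\<close> NA z y 2 show False by blast
      qed
      then show ?thesis using y 2 unfolding removable_iff[OF I] removable_iff[OF J] by blast
    qed
    moreover have "up a I \<noteq> None \<longleftrightarrow> up a J \<noteq> None"
    proof -
      have "\<not> y < z" if z: "z \<in> P - J" "\<kappa> z = a" "\<forall>w\<in>P. w < z \<longrightarrow> w \<in> J" for z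
      proof
        assume "y < z"
        then obtain c where c: "covers P c z" "y \<le> c" using lower_cover_above z \<open>y \<in> P\<close> by blast
        then have "c \<in> J" using z unfolding covers_def by blast
        then have "c = y" using above_y c y by auto
        with c NA z y 2 adjacent_sym show False by blast
      qed
      then show ?thesis using y 2 unfolding addable_iff[OF I] addable_iff[OF J] by blast
    qed
    ultimately show ?thesis using 2 by (auto simp: wt_def shift_def)
  next
    case 3
    have adj: "w < v \<or> v < w" if "w \<in> P" "v \<in> P" "\<kappa> w = a" "adjacent \<Gamma> a (\<kappa> v)" for w v
      using AC[of w v] that adjacent_irrefl by (metis order_le_less)
    have "x \<in> I"
    proof (rule ccontr)
      assume "x \<notin> I"
      have "y \<notin> insert x B" using y assms(4) 3 a by auto
      then have "\<not> y < x" using order_idealD'[OF assms(3), of x y] \<open>y \<in> P\<close> by auto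
      then have "x < y" using adj[of x y] assms 3 y \<open>y \<in> P\<close> by auto
      then show False using below_y assms \<open>x \<notin> I\<close> by auto
    qed
    have "finite {z\<in>I. \<kappa> z = a}" "{z\<in>I. \<kappa> z = a} \<noteq> {}"
      using order_ideal_finite[OF I] \<open>x \<in> I\<close> a by auto
    from finite_has_maximal[OF this] obtain z where z: "z \<in> I" "\<kappa> z = a"
      and "\<And>w. w \<in> I \<Longrightarrow> \<kappa> w = a \<Longrightarrow> z \<le> w \<Longrightarrow> z = w" by auto
    then have z_max: "w \<le> z" if "w \<in> I" "\<kappa> w = a" for w
      using EC[of w z] that IP by (metis order_refl subsetD)
    have "z \<in> P" using z IP by blast
    have "z < y" using adj[of z y] z \<open>z \<in> P\<close> \<open>y \<in> P\<close> 3 y above_y[of z] by auto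
    have no_down: "down a J = None"
    proof -
      have "\<exists>w\<in>J. z' < w" if "z' \<in> J" "\<kappa> z' = a" for z'
        using that z_max[of z'] y 3 \<open>z < y\<close> by auto
      then show ?thesis using removable_iff[OF J, of a] by blast
    qed
    have y_below: "y < s" if "s \<in> P - I" "\<kappa> s = a" for s
      using adj[of s y] that \<open>y \<in> P\<close> 3 y below_y[of s] by auto
    have no_up: "up a I = None"
      using addable_iff[OF I, of a] y_below y \<open>y \<in> P\<close> by blast
    have cover_adj: "adjacent \<Gamma> a (\<kappa> c)" "c \<in> P" if "covers P z c" for c
      using NA[OF that] that z by (auto simp: covers_def)
    \<comment> \<open>As \<open>down a J\<close> and \<open>up a I\<close> are undefined, the weight
      drops by 1 exactly if one and only one of \<open>down a I\<close> and \<open>up a J\<close> is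
      defined.\<close>
    have "down a I \<noteq> None \<longleftrightarrow> up a J = None"
    proof (cases "{s\<in>P - I. \<kappa> s = a} = {}")
      case True
      then have "up a J = None" using addable_iff[OF J, of a] y by blast
      moreover have "down a I \<noteq> None"
        unfolding removable_iff[OF I]
      proof (intro bexI conjI ballI notI)
        fix w assume w: "w \<in> I" "z < w"
        then obtain c where c: "covers P z c" "c \<le> w"
          using upper_cover_below IP \<open>z \<in> P\<close> by blast
        then have "c \<in> I" using w order_idealD[OF I] by (auto simp: covers_def)
        \<comment> \<open>Without a later element of color \<open>a\<close>, UCB1 allows only
          \<open>y\<close> above \<open>z\<close> in an adjacent color, so no cover of
          \<open>z\<close> inside \<open>I\<close> can block its removal.\<close>
        have "maximal_in_color P \<kappa> z"
          using True z \<open>z \<in> P\<close> z_max unfolding maximal_in_color_def by fastforce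
        from UCB1[OF this] have "card {v \<in> P. z < v \<and> adjacent \<Gamma> a (\<kappa> v)} \<le> 1"
          using z by simp
        moreover have "{c, y} \<subseteq> {v \<in> P. z < v \<and> adjacent \<Gamma> a (\<kappa> v)}"
          using c cover_adj[OF c(1)] \<open>z < y\<close> \<open>y \<in> P\<close> 3 y by (auto simp: covers_def)
        ultimately have "card {c, y} \<le> 1"
          using finite_poset card_mono[of "{v \<in> P. z < v \<and> adjacent \<Gamma> a (\<kappa> v)}" "{c, y}"] by simp
        then show False using \<open>c \<in> I\<close> y by (auto simp: card_insert_if split: if_splits)
      qed (use z in auto)
      ultimately show ?thesis by simp
    next
      case False
      have "finite {s\<in>P - I. \<kappa> s = a}" using finite_poset by auto
      from finite_has_minimal[OF this False] obtain s where s: "s \<in> P" "s \<notin> I" "\<kappa> s = a"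
        and "\<And>w. w \<in> P - I \<Longrightarrow> \<kappa> w = a \<Longrightarrow> w \<le> s \<Longrightarrow> s = w" by auto
      then have s_min: "s \<le> w" if "w \<in> P - I" "\<kappa> w = a" for w
        using EC[of w s] that by (metis DiffD1 order_refl)
      have "y < s" using y_below s by blast
      with \<open>z < y\<close> have "z < s" by simp
      have "consecutive P \<kappa> z s"
        unfolding consecutive_def using z s \<open>z \<in> P\<close> \<open>z < s\<close> z_max s_min
        by (metis DiffI leD)
      from ICE2[OF this] have "card {w\<in>P. z < w \<and> w < s \<and> adjacent \<Gamma> a (\<kappa> w)} = 2"
        using z by simp
      then obtain y1 y2 where E12: "{w\<in>P. z < w \<and> w < s \<and> adjacent \<Gamma> a (\<kappa> w)} = {y1, y2}" "y1 \<noteq> y2"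
        by (auto simp: card_2_iff)
      have "y \<in> {w\<in>P. z < w \<and> w < s \<and> adjacent \<Gamma> a (\<kappa> w)}"
        using \<open>y \<in> P\<close> \<open>z < y\<close> \<open>y < s\<close> 3 y by auto
      with E12 obtain y' where E: "{w\<in>P. z < w \<and> w < s \<and> adjacent \<Gamma> a (\<kappa> w)} = {y, y'}" "y \<noteq> y'"
        by auto
      then have y': "y' \<in> P" "z < y'" "y' < s" by auto
      \<comment> \<open>By ICE2 exactly \<open>y\<close> and \<open>y'\<close> separate
        \<open>z\<close> from the next element \<open>s\<close> of its color. If \<open>y'\<close>
        is already in \<open>I\<close>, it blocks the removal of \<open>z\<close>, and adding
        \<open>y\<close> frees \<open>s\<close>. Otherwise \<open>z\<close> is removable before
        \<open>y\<close> arrives, and \<open>y'\<close> still blocks \<open>s\<close>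
        afterwards.\<close>
      show ?thesis
      proof (cases "y' \<in> I")
        case True
        have "down a I = None"
        proof -
          have "\<exists>w\<in>I. z' < w" if "z' \<in> I" "\<kappa> z' = a" for z'
            using z_max[OF that] y' True by (auto intro: le_less_trans)
          then show ?thesis using removable_iff[OF I, of a] by blast
        qed
        moreover have "up a J \<noteq> None"
          unfolding addable_iff[OF J]
        proof (intro bexI conjI ballI impI)
          fix w assume w: "w \<in> P" "w < s"
          then obtain c where c: "covers P c s" "w \<le> c" using lower_cover_above s by blast
          then have cP: "c \<in> P" "c < s" "adjacent \<Gamma> a (\<kappa> c)"
            using NA[OF c(1)] adjacent_sym s by (auto simp: covers_def)
          then consider "z < c" | "c < z" using adj[of z c] z \<open>z \<in> P\<close> by auto
          then have "c \<in> J"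
          proof cases
            case 1
            with cP have "c \<in> {w\<in>P. z < w \<and> w < s \<and> adjacent \<Gamma> a (\<kappa> w)}" by simp
            then have "c \<in> {y, y'}" unfolding E(1) .
            then show ?thesis using True y by auto
          next
            case 2
            then show ?thesis using order_idealD'[OF I z(1) cP(1)] y by auto
          qed
          then show "w \<in> J" using order_idealD[OF J _ w(1)] c by auto
        qed (use s y 3 in auto)
        ultimately show ?thesis by simp
      next
        case False
        have "down a I \<noteq> None"
          unfolding removable_iff[OF I]
        proof (intro bexI conjI ballI notI)
          fix w assume w: "w \<in> I" "z < w"
          then obtain c where c: "covers P z c" "c \<le> w"
            using upper_cover_below IP \<open>z \<in> P\<close> by blast
          then have "c \<in> I" using w order_idealD[OF I] by (auto simp: covers_def)
          then have "\<not> s < c" using order_idealD'[OF I, of c s] s by auto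
          then have "c < s" using adj[of s c] s cover_adj[OF c(1)] by auto
          with c cover_adj[OF c(1)] have "c \<in> {w\<in>P. z < w \<and> w < s \<and> adjacent \<Gamma> a (\<kappa> w)}"
            by (simp add: covers_def)
          then have "c \<in> {y, y'}" unfolding E(1) .
          then show False using False \<open>c \<in> I\<close> y by auto
        qed (use z in auto)
        moreover have "up a J = None"
        proof -
          have "\<exists>w\<in>P. w < t \<and> w \<notin> J" if "t \<in> P - J" "\<kappa> t = a" for t
            using s_min[of t] that y y' E(2) False by (intro bexI[of _ y']) auto
          then show ?thesis using addable_iff[OF J, of a] by blast
        qed
        ultimately show ?thesis by simp
      qed
    qed
    then show ?thesis using no_up no_down 3 by (auto simp: wt_def shift_def)
  qed
qed

end

subsection \<open>Triangularity of the stackwise vectors\<close>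

definition cnt :: "'a set list \<Rightarrow> 'a \<Rightarrow> nat" where
  "cnt T x = length (filter (\<lambda>I. x \<in> I) T)"

lemma cnt_simps [simp]: "cnt [] x = 0" "cnt (I # T) x = of_bool (x \<in> I) + cnt T x"
  by (simp_all add: cnt_def)

lemma cnt_le: "cnt T x \<le> length T"
  by (simp add: cnt_def)

inductive lowered :: "('i \<Rightarrow> 'i option) \<Rightarrow> nat \<Rightarrow> 'i list \<Rightarrow> 'i list \<Rightarrow> bool" for g where
  Nil: "lowered g 0 [] []"
| keep: "lowered g k T T' \<Longrightarrow> lowered g k (I # T) (I # T')"
| lower: "lowered g k T T' \<Longrightarrow> g I = Some J \<Longrightarrow> lowered g (Suc k) (I # T) (J # T')"

lemma dpow_support:
  "dpow g k u T \<noteq> 0 \<Longrightarrow> \<exists>T'. lowered g k T T' \<and> u T' \<noteq> 0"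
proof (induction T arbitrary: k u)
  case Nil
  then show ?case by (auto intro: lowered.Nil split: if_splits)
next
  case (Cons I T)
  show ?case
  proof (cases "dpow g k (\<lambda>L. u (I # L)) T = 0")
    case True
    then obtain J l where "g I = Some J" "k = Suc l" "dpow g l (\<lambda>L. u (J # L)) T \<noteq> 0"
      using Cons.prems by (auto split: option.splits nat.splits)
    then show ?thesis using Cons.IH by (metis lowered.lower)
  next
    case False
    then show ?thesis using Cons.IH by (metis lowered.keep)
  qed
qed

text \<open>A term is nonzero only if every factor containing \<open>x\<close> is lowered. With
  \<open>k\<close> at most the number of these factors there is no choice of positions left: either
  \<open>k\<close> is too small, or exactly these factors are used.\<close>

lemma dpow_forced:
  assumes "\<And>L I. u L \<noteq> 0 \<Longrightarrow> I \<in> set L \<Longrightarrow> x \<notin> I"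
    and "\<And>I. I \<in> set T \<Longrightarrow> x \<in> I \<Longrightarrow> g I = Some (I - {x})" and "k \<le> cnt T x"
  shows "dpow g k u T = (if cnt T x = k then u (map (\<lambda>I. I - {x}) T) else 0)"
  using assms
proof (induction T arbitrary: k u)
  case (Cons I T)
  show ?case
  proof (cases "x \<in> I")
    case True
    then have "u (I # L) = 0" for L using Cons.prems(1)[of "I # L" I] by auto
    then have "(\<lambda>L. u (I # L)) = (\<lambda>L. 0)" by auto
    moreover have "dpow g l (\<lambda>L. u ((I - {x}) # L)) T =
      (if cnt T x = l then u ((I - {x}) # map (\<lambda>I. I - {x}) T) else 0)" if "k = Suc l" for l
      using Cons.prems True that
      by (intro Cons.IH) (auto dest: Cons.prems(1)[of "(I - {x}) # _"])
    moreover have "g I = Some (I - {x})" using Cons.prems True by auto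
    ultimately show ?thesis using True by (cases k) (simp_all add: dpow_zero)
  next
    case False
    have IH: "dpow g l (\<lambda>L. u (J # L)) T =
      (if cnt T x = l then u (J # map (\<lambda>I. I - {x}) T) else 0)" if "l \<le> k" for J l
      using Cons.prems False that
      by (intro Cons.IH) (auto dest: Cons.prems(1)[of "J # _"])
    have "k \<le> cnt T x" using Cons.prems(3) False by simp
    then show ?thesis using False
      by (auto simp: IH split: option.split nat.split)
  qed
qed simp

text \<open>The members of a decreasing list that contain \<open>x\<close> form an initial segment,
  so a flag can be recovered from its counts.\<close>

lemma flag_nth_iff:
  assumes "sorted_wrt (\<lambda>I J. J \<subseteq> I) F" "j < length F"
  shows "x \<in> F ! j \<longleftrightarrow> j < cnt F x"
  using assms
proof (induction F arbitrary: j)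
  case (Cons I F)
  have "cnt F x = 0" if "x \<notin> I"
    using Cons.prems(1) that by (auto simp: cnt_def filter_empty_conv)
  then show ?case
    using Cons.IH Cons.prems by (cases j; cases "x \<in> I") auto
qed simp

context d_complete_poset
begin

text \<open>A strictly increasing rank. When an operator meant to add \<open>x\<close> adds a lower
  element of the same color instead, the total height falls short.\<close>

definition height :: "'a \<Rightarrow> nat" where
  "height x = card {y \<in> P. y \<le> x}"

lemma height_strict_mono: "x \<in> P \<Longrightarrow> y \<in> P \<Longrightarrow> x < y \<Longrightarrow> height x < height y"
  unfolding height_def using finite_poset
  by (intro psubset_card_mono) (auto simp: less_le_not_le dest: order.trans)

definition total_height :: "'a set list \<Rightarrow> nat" where
  "total_height T = sum_list (map (sum height) T)"

lemma total_height_simps [simp]: 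
  "total_height [] = 0"
  "total_height (I # T) = sum height I + total_height T"
  "total_height (A @ T) = total_height A + total_height T"
  by (simp_all add: total_height_def)

definition between :: "'a set \<Rightarrow> 'a set \<Rightarrow> 'a set \<Rightarrow> bool" where
  "between B C I \<longleftrightarrow> order_ideal I \<and> B \<subseteq> I \<and> I \<subseteq> C"

lemma total_height_cnt:
  assumes "finite C" "\<forall>I\<in>set T. between B C I" 
  shows "total_height T = length T * sum height B + (\<Sum>x\<in>C - B. cnt T x * height x)"
  using assms(2)
proof (induction T)
  case (Cons I T)
  have I: "B \<subseteq> I" "I \<subseteq> C" "finite I"
    using Cons.prems assms(1) finite_subset by (auto simp: between_def)
  have "sum height I = sum height B + sum height (I - B)"
    using I by (metis add.commute sum.subset_diff)
  also have "sum height (I - B) = (\<Sum>x\<in>C - B. of_bool (x \<in> I) * height x)"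
    using I assms(1) by (intro sum.mono_neutral_cong_left) auto
  finally show ?case
    using Cons by (simp add: algebra_simps sum.distrib)
qed simp

text \<open>A saturated chain of ideals from \<open>B\<close> to \<open>P\<close>: the tail of a
  linear extension, which makes the stack construction available at every stage \<open>B\<close> of
  the downward induction.\<close>

fun completion :: "'a set \<Rightarrow> 'a list \<Rightarrow> bool" where
  "completion B [] \<longleftrightarrow> B = P"
| "completion B (x # xs) \<longleftrightarrow> x \<in> P - B \<and> order_ideal (insert x B) \<and> completion (insert x B) xs"

definition stack :: "('a \<Rightarrow> nat) \<Rightarrow> 'a list \<Rightarrow> ('a set list \<Rightarrow> complex) \<Rightarrow> 'a set list \<Rightarrow> complex" where
  "stack \<psi> = fold (\<lambda>x. dpow (down (\<kappa> x)) (\<psi> x))"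

text \<open>The invariant of the stack once the elements of \<open>C - B\<close> have been
  processed. The multiple of \<open>sum height B\<close> is the contribution of the starting ideals.
  The leading value 1 is claimed at every tensor with the right counts, whether or not it is a
  flag.\<close>

definition leads :: "'a set \<Rightarrow> 'a set \<Rightarrow> nat \<Rightarrow> ('a \<Rightarrow> nat) \<Rightarrow> ('a set list \<Rightarrow> complex) \<Rightarrow> bool" where
  "leads B C m \<psi> u \<longleftrightarrow>
     (\<forall>T. u T \<noteq> 0 \<longrightarrow> length T = m \<and> (\<forall>I\<in>set T. between B C I) \<and>
        total_height T \<le> m * sum height B + (\<Sum>x\<in>C - B. \<psi> x * height x) \<and>
        (total_height T = m * sum height B + (\<Sum>x\<in>C - B. \<psi> x * height x) \<longrightarrow> (\<forall>x\<in>C - B. cnt T x = \<psi> x))) \<and>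
     (\<forall>T. length T = m \<and> (\<forall>I\<in>set T. between B C I) \<and> (\<forall>x\<in>C - B. cnt T x = \<psi> x) \<longrightarrow> u T = 1)"

lemma leads_base: "order_ideal B \<Longrightarrow> leads B B m \<psi> (\<lambda>L. of_bool (L = replicate m B))"
proof -
  assume "order_ideal B"
  have "total_height (replicate m B) = m * sum height B" by (induction m) auto
  moreover have "T = replicate m B" if "length T = m" "\<forall>I\<in>set T. between B B I" for T
    using that by (intro replicate_eqI) (auto simp: between_def)
  ultimately show ?thesis
    using \<open>order_ideal B\<close> by (auto simp: leads_def between_def)
qed

text \<open>By EC an element \<open>z\<close> added to a factor is comparable to \<open>x\<close>.
  It cannot lie above \<open>x\<close>, which is still missing there, so it is \<open>x\<close>
  itself or a lower member of \<open>C\<close>. Equality of heights therefore means that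
  \<open>x\<close> was added all \<open>k\<close> times.\<close>

lemma lowered_between:
  assumes "lowered (down (\<kappa> x)) k T T'" "\<forall>I\<in>set T'. between B C I"
    and "order_ideal (insert x C)" "x \<in> P - C"
  shows "length T = length T' \<and> (\<forall>I\<in>set T. between B (insert x C) I) \<and>
    total_height T \<le> total_height T' + k * height x \<and>
    (total_height T = total_height T' + k * height x \<longrightarrow> (\<forall>y\<in>C. cnt T y = cnt T' y) \<and> cnt T x = k)"
  using assms(1,2)
proof (induction rule: lowered.induct)
  case (keep k T T' I)
  have "x \<notin> I" using keep.prems assms(4) by (auto simp: between_def)
  moreover have "between B (insert x C) I" using keep.prems by (auto simp: between_def)
  moreover note keep.IH keep.prems
  ultimately show ?case by simp
next
  case (lower k T T' I J)
  from lower.hyps obtain z where z: "z \<notin> J" "\<kappa> z = \<kappa> x" "I = insert z J"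
    and I: "order_ideal J" "order_ideal I"
    by (auto simp: down_eq_Some step_def)
  have J: "B \<subseteq> J" "J \<subseteq> C" "x \<notin> J" using lower.prems assms(4) by (auto simp: between_def)
  have P: "z \<in> P" "x \<in> P" using order_ideal_subset[OF I(2)] z assms(4) by auto
  have z_le: "z = x \<or> z \<in> C \<and> height z < height x"
    using P z(2)
  proof (cases rule: color_cases)
    case 2
    then show ?thesis
      using order_idealD'[OF assms(3) _ P(1)] height_strict_mono P by auto
  next
    case 3
    then show ?thesis
      using order_idealD'[OF I(2) _ P(2)] z J by auto
  qed simp
  have "sum height I = height z + sum height J"
    using z order_ideal_finite[OF I(1)] by simp
  moreover have "between B (insert x C) I" using I J z z_le by (auto simp: between_def)
  moreover have "height z = height x \<longrightarrow> z = x" "height z \<le> height x" using z_le by auto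
  moreover have "\<forall>y\<in>C. y \<in> insert x J \<longleftrightarrow> y \<in> J" using assms(4) by auto
  ultimately show ?case
    using lower.IH lower.prems J(3) z(3) by auto
qed simp

lemma leads_step:
  assumes "leads B C m \<psi> u" "order_ideal C" "B \<subseteq> C" "x \<in> P - C" "order_ideal (insert x C)"
  shows "leads B (insert x C) m \<psi> (dpow (down (\<kappa> x)) (\<psi> x) u)"
proof -
  have C: "insert x C - B = insert x (C - B)" "x \<notin> C - B" "finite (C - B)"
    using assms order_ideal_finite by auto
  note u1 = assms(1)[unfolded leads_def, THEN conjunct1, rule_format]
  note u2 = assms(1)[unfolded leads_def, THEN conjunct2, rule_format]
  show ?thesis
    unfolding leads_def
  proof (intro conjI allI impI)
    fix T assume "dpow (down (\<kappa> x)) (\<psi> x) u T \<noteq> 0"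
    from dpow_support[OF this] obtain T' where T': "lowered (down (\<kappa> x)) (\<psi> x) T T'" "u T' \<noteq> 0"
      by blast
    note l = lowered_between[OF T'(1) _ assms(5,4), of B]
    note u = u1[OF T'(2)]
    show "length T = m" "\<forall>I\<in>set T. between B (insert x C) I" using l u by auto
    show "total_height T \<le> m * sum height B + (\<Sum>x\<in>insert x C - B. \<psi> x * height x)"
      using l u C by auto
    show "\<forall>y\<in>insert x C - B. cnt T y = \<psi> y"
      if "total_height T = m * sum height B + (\<Sum>x\<in>insert x C - B. \<psi> x * height x)"
    proof -
      have "total_height T = m * sum height B + (\<psi> x * height x + (\<Sum>x\<in>C - B. \<psi> x * height x))"
        using that C by simp
      then have "total_height T = total_height T' + \<psi> x * height x"
        "total_height T' = m * sum height B + (\<Sum>x\<in>C - B. \<psi> x * height x)"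
        using l u by auto
      then show ?thesis using l u by auto
    qed
  next
    fix T assume T: "length T = m \<and> (\<forall>I\<in>set T. between B (insert x C) I) \<and>
      (\<forall>y\<in>insert x C - B. cnt T y = \<psi> y)"
    have I: "order_ideal (I - {x})" if "I \<in> set T" for I
    proof -
      have "I - {x} = I \<inter> C" using that T assms(4) by (auto simp: between_def)
      then show ?thesis using order_ideal_Int assms(2) that T by (auto simp: between_def)
    qed
    have Tx: "cnt T x = \<psi> x" using T unfolding C(1) by simp
    have "dpow (down (\<kappa> x)) (\<psi> x) u T =
      (if cnt T x = \<psi> x then u (map (\<lambda>I. I - {x}) T) else 0)"
    proof (rule dpow_forced)
      show "x \<notin> I" if "u L \<noteq> 0" "I \<in> set L" for L I
        using u1[OF that(1)] that(2) assms(4) by (auto simp: between_def)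
      show "down (\<kappa> x) I = Some (I - {x})" if "I \<in> set T" "x \<in> I" for I
        using I[OF that(1)] T that unfolding down_eq_Some step_def
        by (auto simp: between_def)
      show "\<psi> x \<le> cnt T x" by (simp add: Tx)
    qed
    also have "\<dots> = u (map (\<lambda>I. I - {x}) T)" by (simp add: Tx)
    also have "\<dots> = 1"
    proof (rule u2, intro conjI ballI)
      show "between B C I" if "I \<in> set (map (\<lambda>I. I - {x}) T)" for I
        using that T I assms by (auto simp: between_def)
      show "cnt (map (\<lambda>I. I - {x}) T) y = \<psi> y" if "y \<in> C - B" for y
      proof -
        have "cnt (map (\<lambda>I. I - {x}) T) y = cnt T y"
          using that assms(4) by (auto simp: cnt_def filter_map o_def intro!: arg_cong[where f = length] filter_cong)
        then show ?thesis using T that by simp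
      qed
    qed (use T in simp)
    finally show "dpow (down (\<kappa> x)) (\<psi> x) u T = 1" .
  qed
qed

lemma leads_stack:
  "completion C xs \<Longrightarrow> order_ideal C \<Longrightarrow> B \<subseteq> C \<Longrightarrow> leads B C m \<psi> u \<Longrightarrow> leads B P m \<psi> (stack \<psi> xs u)"
proof (induction xs arbitrary: C u)
  case (Cons x xs)
  then show ?case
    using Cons.IH[of "insert x C" "dpow (down (\<kappa> x)) (\<psi> x) u"] leads_step[of B C m \<psi> u x]
    by (auto simp: stack_def)
qed (simp add: stack_def)

lemma cyclic_dpow:
  assumes "u \<in> cyclic down L\<^sub>0"
  shows "dpow (down a) k u \<in> cyclic down L\<^sub>0"
proof -
  have "(leib (down a) ^^ k) u \<in> cyclic down L\<^sub>0"
    using assms by (induction k) (auto intro: cyclic.leib)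
  from cyclic.scale[OF this, of "1 / fact k"] show ?thesis
    by (simp add: string.dpow_power)
qed

lemma cyclic_stack: "u \<in> cyclic down L\<^sub>0 \<Longrightarrow> stack \<psi> xs u \<in> cyclic down L\<^sub>0"
  by (induction xs arbitrary: u) (simp_all add: stack_def cyclic_dpow)

section \<open>Flags and the unitriangular matrix of their vectors\<close>

definition flags :: "'a set \<Rightarrow> nat \<Rightarrow> 'a set list set" where
  "flags B m = {F. length F = m \<and> sorted_wrt (\<lambda>I J. J \<subseteq> I) F \<and> (\<forall>I\<in>set F. between B P I)}"

lemma finite_flags: "finite (flags B m)"
  by (rule finite_subset[OF _ finite_lists_length_eq[of "Pow P" m]])
    (auto simp: flags_def between_def finite_poset)

lemma flag_eqI:
  assumes "F \<in> flags B m" "F' \<in> flags B m" "\<And>x. x \<in> P - B \<Longrightarrow> cnt F x = cnt F' x"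
  shows "F = F'"
proof (rule nth_equalityI)
  show len: "length F = length F'" using assms by (simp add: flags_def)
  fix j assume j: "j < length F"
  have "x \<in> F ! j \<longleftrightarrow> x \<in> F' ! j" if "x \<in> P - B" for x
    using that assms j len by (simp add: flags_def flag_nth_iff)
  moreover have "between B P (F ! j)" "between B P (F' ! j)"
    using assms j len by (auto simp: flags_def)
  ultimately show "F ! j = F' ! j"
    unfolding between_def by blast
qed

text \<open>The stackwise vectors, started at an arbitrary ideal \<open>B\<close> and indexed by
  flags instead of P-partitions.\<close>

definition flag_vector :: "'a set \<Rightarrow> 'a list \<Rightarrow> 'a set list \<Rightarrow> 'a set list \<Rightarrow> complex" where
  "flag_vector B xs F = stack (cnt F) xs (\<lambda>L. of_bool (L = replicate (length F) B))"

lemma flag_vector_cyclic: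
  "F \<in> flags B m \<Longrightarrow> flag_vector B xs F \<in> cyclic down (replicate m B)"
  by (auto simp: flag_vector_def flags_def intro!: cyclic_stack cyclic.base)

context
  fixes B xs and m :: nat
  assumes B: "order_ideal B" and xs: "completion B xs"
begin

lemma flag_vector_leads:
  assumes "F \<in> flags B m"
  shows "leads B P m (cnt F) (flag_vector B xs F)"
  using leads_stack[OF xs B order_refl leads_base[OF B, of m "cnt F"]] assms
  by (simp add: flag_vector_def flags_def)

lemma flag_vector_self:
  assumes "F \<in> flags B m"
  shows "flag_vector B xs F F = 1"
  using assms
  by (intro flag_vector_leads[OF assms, unfolded leads_def, THEN conjunct2, rule_format])
    (auto simp: flags_def)

lemma flag_vector_support:
  assumes "F \<in> flags B m" "flag_vector B xs F T \<noteq> 0"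
  shows "total_height T \<le> total_height F" "total_height T = total_height F \<Longrightarrow> x \<in> P - B \<Longrightarrow> cnt T x = cnt F x"
  using flag_vector_leads[OF assms(1), unfolded leads_def, THEN conjunct1, rule_format, OF assms(2)]
    assms(1) total_height_cnt[OF finite_poset, of F B]
  by (simp_all add: flags_def)

lemma flag_vector_triangular:
  assumes "F \<in> flags B m" "F' \<in> flags B m" "flag_vector B xs F F' \<noteq> 0" "F \<noteq> F'"
  shows "total_height F' < total_height F"
proof -
  have "total_height F' \<noteq> total_height F"
  proof
    assume "total_height F' = total_height F"
    then have "F = F'"
      using flag_vector_support(2)[OF assms(1,3)] by (intro flag_eqI[OF assms(1,2)]) simp
    with assms(4) show False by simp
  qed
  with flag_vector_support(1)[OF assms(1,3)] show ?thesis by simp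
qed

text \<open>Triangularity read as an existence statement; it supplies the auxiliary vector in the
  weight zero case.\<close>

lemma flag_interpolation:
  obtains y where "y \<in> cyclic down (replicate m B)" "\<And>F. F \<in> flags B m \<Longrightarrow> y F = t F"
proof -
  note solve = triangular_solve[where A = "flags B m" and c = "flag_vector B xs" and r = total_height and t = t,
      OF finite_flags flag_vector_self flag_vector_triangular]
  from solve obtain d
    where d: "\<forall>F'\<in>flags B m. (\<Sum>F\<in>flags B m. d F * flag_vector B xs F F') = t F'" by auto
  have "(\<lambda>T. \<Sum>F\<in>flags B m. d F * flag_vector B xs F T) \<in> cyclic down (replicate m B)"
    by (intro cyclic_sum cyclic.scale flag_vector_cyclic)
  then show ?thesis by (rule that) (simp add: d)
qed

end

end

context d_complete_poset
begin

subsection \<open>Vectors in two tensor factors are determined by their values on flags\<close>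

definition separated :: "'a set \<Rightarrow> bool" where
  "separated B \<longleftrightarrow> (\<forall>u\<in>cyclic down (replicate 2 B). (\<forall>F\<in>flags B 2. u F = 0) \<longrightarrow> u = (\<lambda>L. 0))"

lemma flags_2: "F \<in> flags B 2 \<longleftrightarrow> (\<exists>K L. F = [K, L] \<and> L \<subseteq> K \<and> between B P K \<and> between B P L)"
  by (auto simp: flags_def numeral_2_eq_2 length_Suc_conv)

lemma down_closed_above:
  "down b I = Some J \<Longrightarrow> order_ideal J \<and> B \<subseteq> J \<Longrightarrow> order_ideal I \<and> B \<subseteq> I"
  by (auto simp: down_eq_Some step_def)

lemma cyclic_support_above:
  assumes "u \<in> cyclic down (replicate m B)" "u L \<noteq> 0" "order_ideal B"
  shows "length L = m \<and> (\<forall>I\<in>set L. between B P I)"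
  using cyclic_support[where S = "\<lambda>I. order_ideal I \<and> B \<subseteq> I" and G = down, OF assms(1,2)]
    assms(3) down_closed_above order_ideal_subset
  unfolding between_def by blast

text \<open>The element removed from \<open>K\<close> is maximal in \<open>K\<close>; if it lay in
  \<open>L\<close> it would be maximal there and removable. With \<open>flag_lower_both\<close> this
  shows that X on flags of weight 1, and X^2 on all flags, involve only values at flags.\<close>

lemma flag_lower_larger:
  assumes "order_ideal L" "L \<subseteq> K" "down a K = Some K'" "down a L = None"
  shows "L \<subseteq> K'"
proof -
  obtain z where z: "z \<notin> K'" "\<kappa> z = a" "K = insert z K'" and I: "order_ideal K'" "order_ideal K"
    using assms(3) by (auto simp: down_eq_Some step_def)
  have "z \<in> P" using z order_ideal_subset[OF I(2)] by auto
  have "z \<notin> L"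
  proof
    assume "z \<in> L"
    moreover have "\<not> z < w" if "w \<in> L" for w
      using that assms(2) z order_idealD'[OF I(1) _ \<open>z \<in> P\<close>, of w] by auto
    ultimately show False using removable_iff[OF assms(1), of a] z assms(4) by blast
  qed
  with assms z show ?thesis by auto
qed

lemma flag_lower_both:
  assumes "L \<subseteq> K" "down a K = Some K'" "down a L = Some L'"
  shows "L' \<subseteq> K'"
proof -
  obtain z where z: "z \<notin> K'" "\<kappa> z = a" "K = insert z K'" and I: "order_ideal K'" "order_ideal K"
    using assms(2) by (auto simp: down_eq_Some step_def)
  obtain z' where z': "z' \<notin> L'" "\<kappa> z' = a" "L = insert z' L'" and I': "order_ideal L'" "order_ideal L"
    using assms(3) by (auto simp: down_eq_Some step_def)
  have P: "z \<in> P" "z' \<in> P" "\<kappa> z = \<kappa> z'"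
    using z z' order_ideal_subset[OF I(2)] order_ideal_subset[OF I'(2)] by auto
  have "z' \<in> K" using z' assms(1) by auto
  have "z \<notin> L'"
    using P
  proof (cases rule: color_cases)
    case 2
    then have "z' \<in> K'" using \<open>z' \<in> K\<close> z by auto
    then show ?thesis using order_idealD'[OF I(1) _ P(1) 2] z by auto
  next
    case 3
    then show ?thesis using order_idealD'[OF I'(1) _ P(2) 3] z' by auto
  qed (use z' in auto)
  with assms z z' show ?thesis by auto
qed

section \<open>The downward step from \<open>insert x B\<close> to \<open>B\<close>\<close>

context
  fixes B :: "'a set" and x :: 'a and xs :: "'a list" and a :: 'c
  assumes B: "order_ideal B" and x: "x \<in> P - B" and B': "order_ideal (insert x B)"
    and xs: "completion (insert x B) xs" and sep: "separated (insert x B)"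
    and a: "a = \<kappa> x"
begin

private abbreviation (input) "N \<equiv> cyclic down (replicate 2 (insert x B))"
private abbreviation (input) "X \<equiv> leib (down a)"
private abbreviation (input) "Y \<equiv> leib (up a)"
private abbreviation (input) "weight \<equiv> wts (down a) (up a)"

lemma N_support: "n \<in> N \<Longrightarrow> n L \<noteq> 0 \<Longrightarrow> length L = 2 \<and> (\<forall>I\<in>set L. between (insert x B) P I)"
  by (rule cyclic_support_above[OF _ _ B'])

lemma N_weight:
  fixes p :: "int \<Rightarrow> complex"
  assumes "n \<in> N"
  shows "(\<lambda>L. p (weight L) * n L) \<in> N"
proof (rule cyclic_weight[where S = "\<lambda>I. order_ideal I \<and> insert x B \<subseteq> I" and s = "shift a", OF assms])
  show "order_ideal I \<and> insert x B \<subseteq> I"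
    if "down b I = Some J" "order_ideal J \<and> insert x B \<subseteq> J" for b I J
    using down_closed_above[OF that] .
  show "wt (down a) (up a) I = wt (down a) (up a) J + shift a b"
    if "down b I = Some J" "order_ideal J \<and> insert x B \<subseteq> J" for b I J
    using wt_shift[OF B x B' _ _ a] that by (auto simp: down_eq_Some)
qed (use B' in simp)

text \<open>Two powers of \<open>Y\<close> suffice: the generator for \<open>B\<close> is half of
  Y^2 applied to the generator for \<open>insert x B\<close>, and commuting an adding operator past
  \<open>Y\<close> never raises the power of \<open>Y\<close>.\<close>

private definition M :: "('a set list \<Rightarrow> complex) set" where
  "M = {u. \<exists>n\<^sub>0\<in>N. \<exists>n\<^sub>1\<in>N. \<exists>n\<^sub>2\<in>N. u = (\<lambda>L. n\<^sub>0 L + Y n\<^sub>1 L + Y (Y n\<^sub>2) L)}"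

lemma M_I:
  "n\<^sub>0 \<in> N \<Longrightarrow> n\<^sub>1 \<in> N \<Longrightarrow> n\<^sub>2 \<in> N \<Longrightarrow> (\<And>L. u L = n\<^sub>0 L + Y n\<^sub>1 L + Y (Y n\<^sub>2) L) \<Longrightarrow> u \<in> M"
  unfolding M_def by blast

lemma M_E:
  assumes "u \<in> M"
  obtains n\<^sub>0 n\<^sub>1 n\<^sub>2 where "n\<^sub>0 \<in> N" "n\<^sub>1 \<in> N" "n\<^sub>2 \<in> N"
    "\<And>L. u L = n\<^sub>0 L + Y n\<^sub>1 L + Y (Y n\<^sub>2) L"
  using assms unfolding M_def by auto

lemma M_base: "(\<lambda>L. of_bool (L = replicate 2 B)) \<in> M"
proof (rule M_I)
  let ?d = "\<lambda>L. of_bool (L = replicate 2 (insert x B)) :: complex"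
  show "(\<lambda>L. 0) \<in> N" "(\<lambda>L. 0) \<in> N" "(\<lambda>L. (1 / 2) * ?d L) \<in> N"
    by (rule cyclic_zero cyclic.scale cyclic.base)+
  fix L
  have up: "up a I = Some (insert x B) \<longleftrightarrow> I = B" for I
    using step_unique_lower[of a I "insert x B" B] B B' x a
    by (auto simp: up_eq_Some step_def)
  have "of_bool (L = replicate 2 B) = (1 / 2) * Y (Y ?d) L"
  proof (cases "length L = 2")
    case True
    then obtain I J where L: "L = [I, J]" by (auto simp: numeral_2_eq_2 length_Suc_conv)
    have "Y (Y ?d) [I, J] =
      2 * (case up a I of None \<Rightarrow> 0 | Some I' \<Rightarrow> case up a J of None \<Rightarrow> 0 | Some J' \<Rightarrow> ?d [I', J'])"
      by (rule leib_leib_pair) (rule string.nilpotent')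
    also have "\<dots> = 2 * of_bool (up a I = Some (insert x B) \<and> up a J = Some (insert x B))"
      by (auto simp: numeral_2_eq_2 split: option.split)
    finally show ?thesis unfolding L up by (simp add: numeral_2_eq_2)
  next
    case False
    have *: "length L = 2" if "Y ?d L \<noteq> 0" for L
      using that by (rule leib_length[rotated]) auto
    have "length L = 2" if "Y (Y ?d) L \<noteq> 0"
      using that by (rule leib_length[rotated]) (rule *)
    with False have "Y (Y ?d) L = 0" by blast
    with False show ?thesis by auto
  qed
  then show "of_bool (L = replicate 2 B) =
    0 + Y (\<lambda>L. 0) L + Y (Y (\<lambda>L. (1 / 2) * ?d L)) L"
    by (simp only: leib_scale' leib_zero add_0)
qed

lemma M_add: "u \<in> M \<Longrightarrow> v \<in> M \<Longrightarrow> (\<lambda>L. u L + v L) \<in> M"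
proof (elim M_E)
  fix n\<^sub>0 n\<^sub>1 n\<^sub>2 k\<^sub>0 k\<^sub>1 k\<^sub>2
  assume n: "n\<^sub>0 \<in> N" "n\<^sub>1 \<in> N" "n\<^sub>2 \<in> N" "\<And>L. u L = n\<^sub>0 L + Y n\<^sub>1 L + Y (Y n\<^sub>2) L"
    and k: "k\<^sub>0 \<in> N" "k\<^sub>1 \<in> N" "k\<^sub>2 \<in> N" "\<And>L. v L = k\<^sub>0 L + Y k\<^sub>1 L + Y (Y k\<^sub>2) L"
  show ?thesis
    by (rule M_I[OF cyclic.add[OF n(1) k(1)] cyclic.add[OF n(2) k(2)] cyclic.add[OF n(3) k(3)]])
      (simp add: leib_add' n(4) k(4))
qed

lemma M_scale: "u \<in> M \<Longrightarrow> (\<lambda>L. c * u L) \<in> M"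
proof (elim M_E)
  fix n\<^sub>0 n\<^sub>1 n\<^sub>2
  assume n: "n\<^sub>0 \<in> N" "n\<^sub>1 \<in> N" "n\<^sub>2 \<in> N" "\<And>L. u L = n\<^sub>0 L + Y n\<^sub>1 L + Y (Y n\<^sub>2) L"
  show ?thesis
    by (rule M_I[OF cyclic.scale[OF n(1)] cyclic.scale[OF n(2)] cyclic.scale[OF n(3)]])
      (simp add: leib_scale' n(4) algebra_simps)
qed

lemma M_leib: "u \<in> M \<Longrightarrow> leib (down b) u \<in> M"
proof (elim M_E)
  fix n\<^sub>0 n\<^sub>1 n\<^sub>2
  assume n: "n\<^sub>0 \<in> N" "n\<^sub>1 \<in> N" "n\<^sub>2 \<in> N" "\<And>L. u L = n\<^sub>0 L + Y n\<^sub>1 L + Y (Y n\<^sub>2) L"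
  then have u: "u = (\<lambda>L. n\<^sub>0 L + Y n\<^sub>1 L + Y (Y n\<^sub>2) L)" by blast
  show ?thesis
  proof (cases "b = a")
    case False
    then have *: "leib (down b) (Y v) = Y (leib (down b) v)" for v
      using leib_down_up_commute[of a b] by auto
    show ?thesis
      unfolding u leib_add' *
      by (rule M_I[OF cyclic.leib[OF n(1)] cyclic.leib[OF n(2)] cyclic.leib[OF n(3)]]) simp
  next
    case True
    let ?H = "\<lambda>v L. of_int (weight L) * v L :: complex"
    have XY: "X (Y v) = (\<lambda>L. Y (X v) L + ?H v L)" for v
      using string.commutator by blast
    have HY: "?H (Y v) L = Y (\<lambda>L. of_int (weight L - 2) * v L) L" for v L
      by (rule string.wts_leib_h)
    \<comment> \<open>Moving X past both copies of Y gives X Y^2 = Y^2 X + Y H + H Y, and H Y = Y (H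
      - 2). The weight factors are absorbed into \<open>N\<close> by
      \<open>N_weight\<close>.\<close>
    have XYY: "X (Y (Y n\<^sub>2)) =
      (\<lambda>L. Y (Y (X n\<^sub>2)) L + Y (?H n\<^sub>2) L + Y (\<lambda>L. of_int (weight L - 2) * n\<^sub>2 L) L)"
      unfolding XY HY leib_add' ..
    show ?thesis
      unfolding u leib_add' True XYY XY[of n\<^sub>1]
    proof (rule M_I)
      show "(\<lambda>L. X n\<^sub>0 L + ?H n\<^sub>1 L) \<in> N"
        by (intro cyclic.add cyclic.leib N_weight n)
      show "(\<lambda>L. X n\<^sub>1 L + (?H n\<^sub>2 L + of_int (weight L - 2) * n\<^sub>2 L)) \<in> N"
        by (intro cyclic.add cyclic.leib N_weight N_weight[where p = "\<lambda>c. of_int (c - 2)"] n)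
      show "X n\<^sub>2 \<in> N" by (intro cyclic.leib n)
    qed (simp add: leib_add')
  qed
qed

lemma cyclic_subset_M: "u \<in> cyclic down (replicate 2 B) \<Longrightarrow> u \<in> M"
  by (induction rule: cyclic.induct) (auto intro: M_base M_add M_scale M_leib)

section \<open>Weight components of \<open>M\<close>\<close>

private definition homog :: "int \<Rightarrow> ('a set list \<Rightarrow> complex) \<Rightarrow> bool" where
  "homog c u \<longleftrightarrow> (\<forall>L. u L \<noteq> 0 \<longrightarrow> weight L = c)"

lemma homog_component: "homog c (\<lambda>L. of_bool (weight L = c) * u L)"
  by (simp add: homog_def)

lemma weight_bounds: "length L = 2 \<Longrightarrow> -2 \<le> weight L \<and> weight L \<le> 2"
proof -
  assume "length L = 2"
  then obtain I J where "L = [I, J]" by (auto simp: numeral_2_eq_2 length_Suc_conv)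
  then show ?thesis using string.wt_cases(3,4)[of a I] string.wt_cases(3,4)[of a J] by simp
qed

lemma M_length: "u \<in> M \<Longrightarrow> u L \<noteq> 0 \<Longrightarrow> length L = 2"
proof (elim M_E)
  fix n\<^sub>0 n\<^sub>1 n\<^sub>2
  assume n: "n\<^sub>0 \<in> N" "n\<^sub>1 \<in> N" "n\<^sub>2 \<in> N" "\<And>L. u L = n\<^sub>0 L + Y n\<^sub>1 L + Y (Y n\<^sub>2) L" and "u L \<noteq> 0"
  then consider "n\<^sub>0 L \<noteq> 0" | "Y n\<^sub>1 L \<noteq> 0" | "Y (Y n\<^sub>2) L \<noteq> 0" by force
  then show "length L = 2"
  proof cases
    case 1
    with N_support n show ?thesis by blast
  next
    case 2
    then show ?thesis by (rule leib_length[rotated]) (use N_support n in blast)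
  next
    case 3
    then show ?thesis
    proof (rule leib_length[rotated])
      show "length L = 2" if "Y n\<^sub>2 L \<noteq> 0" for L
        using that by (rule leib_length[rotated]) (use N_support n in blast)
    qed
  qed
qed

lemma M_component:
  fixes p :: "int \<Rightarrow> complex"
  assumes "n\<^sub>0 \<in> N" "n\<^sub>1 \<in> N" "n\<^sub>2 \<in> N"
    "\<And>L. u L = n\<^sub>0 L + Y n\<^sub>1 L + Y (Y n\<^sub>2) L"
  shows "p (weight L) * u L = p (weight L) * n\<^sub>0 L + Y (\<lambda>L. p (weight L - 2) * n\<^sub>1 L) L
    + Y (Y (\<lambda>L. p (weight L - 2 - 2) * n\<^sub>2 L)) L"
proof -
  have Y: "(\<lambda>L. q (weight L) * Y v L) = Y (\<lambda>L. q (weight L - 2) * v L)" for q v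
    using string.wts_leib_h[of q a] by blast
  have "p (weight L) * Y n\<^sub>1 L = Y (\<lambda>L. p (weight L - 2) * n\<^sub>1 L) L"
    using fun_cong[OF Y[of p n\<^sub>1], of L] .
  moreover have "p (weight L) * Y (Y n\<^sub>2) L = Y (Y (\<lambda>L. p (weight L - 2 - 2) * n\<^sub>2 L)) L"
    using fun_cong[OF Y[of p "Y n\<^sub>2"], of L] unfolding Y[of "\<lambda>c. p (c - 2)" n\<^sub>2] .
  ultimately show ?thesis by (simp add: assms(4) distrib_left)
qed

lemma M_weight:
  fixes p :: "int \<Rightarrow> complex"
  assumes "u \<in> M"
  shows "(\<lambda>L. p (weight L) * u L) \<in> M"
  using assms
proof (rule M_E)
  fix n\<^sub>0 n\<^sub>1 n\<^sub>2
  assume n: "n\<^sub>0 \<in> N" "n\<^sub>1 \<in> N" "n\<^sub>2 \<in> N" "\<And>L. u L = n\<^sub>0 L + Y n\<^sub>1 L + Y (Y n\<^sub>2) L"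
  show ?thesis
    by (rule M_I[OF N_weight[OF n(1), of p] N_weight[OF n(2), of "\<lambda>c. p (c - 2)"]
          N_weight[OF n(3), of "\<lambda>c. p (c - 2 - 2)"] M_component[OF n]])
qed

lemma M_homog_E:
  assumes "u \<in> M" "homog c u"
  obtains n\<^sub>0 n\<^sub>1 n\<^sub>2 where "n\<^sub>0 \<in> N" "n\<^sub>1 \<in> N" "n\<^sub>2 \<in> N" "homog (c + 2) n\<^sub>1" "homog (c + 4) n\<^sub>2"
    "\<And>L. u L = n\<^sub>0 L + Y n\<^sub>1 L + Y (Y n\<^sub>2) L"
  using assms(1)
proof (rule M_E)
  fix n\<^sub>0 n\<^sub>1 n\<^sub>2
  assume n: "n\<^sub>0 \<in> N" "n\<^sub>1 \<in> N" "n\<^sub>2 \<in> N" "\<And>L. u L = n\<^sub>0 L + Y n\<^sub>1 L + Y (Y n\<^sub>2) L"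
  define p :: "int \<Rightarrow> complex" where "p = (\<lambda>d. of_bool (d = c))"
  have "u L = p (weight L) * u L" for L
    using assms(2) by (auto simp: homog_def p_def)
  with M_component[OF n, of p] have "u L = p (weight L) * n\<^sub>0 L + Y (\<lambda>L. p (weight L - 2) * n\<^sub>1 L) L
    + Y (Y (\<lambda>L. p (weight L - 2 - 2) * n\<^sub>2 L)) L" for L
    by metis
  moreover have "homog (c + 2) (\<lambda>L. p (weight L - 2) * n\<^sub>1 L)"
    "homog (c + 4) (\<lambda>L. p (weight L - 2 - 2) * n\<^sub>2 L)"
    by (auto simp: homog_def p_def)
  ultimately show thesis
    using that[OF N_weight[OF n(1), of p] N_weight[OF n(2), of "\<lambda>c. p (c - 2)"]
          N_weight[OF n(3), of "\<lambda>c. p (c - 2 - 2)"]] by blast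
qed

lemma N_high_weight:
  assumes "n \<in> N" "homog c n" "2 < c"
  shows "n = (\<lambda>L. 0)"
proof
  fix L
  show "n L = 0"
    using N_support[OF assms(1), of L] weight_bounds[of L] assms(2,3)
    by (force simp: homog_def)
qed

text \<open>The parts of \<open>u\<close> under \<open>Y\<close> and under its square would come
  from vectors of weight at least 3 and 5, but two factors allow at most 2.\<close>

lemma M_positive_weight:
  assumes "u \<in> M" "homog c u" "1 \<le> c"
  shows "u \<in> N"
  using assms(1,2)
proof (rule M_homog_E)
  fix n\<^sub>0 n\<^sub>1 n\<^sub>2
  assume n: "n\<^sub>0 \<in> N" "n\<^sub>1 \<in> N" "n\<^sub>2 \<in> N" "homog (c + 2) n\<^sub>1" "homog (c + 4) n\<^sub>2"
    "\<And>L. u L = n\<^sub>0 L + Y n\<^sub>1 L + Y (Y n\<^sub>2) L"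
  have "n\<^sub>1 = (\<lambda>L. 0)" "n\<^sub>2 = (\<lambda>L. 0)"
    using N_high_weight[OF n(2,4)] N_high_weight[OF n(3,5)] assms(3) by auto
  then have "u = n\<^sub>0" using n(6) by (auto simp: leib_zero')
  with n show ?thesis by simp
qed

lemma homog_X:
  assumes "homog c u"
  shows "homog (c + 2) (X u)"
  unfolding homog_def
proof (intro allI impI)
  fix L assume "X u L \<noteq> 0"
  then obtain A I J C where *: "L = A @ I # C" "down a I = Some J" "u (A @ J # C) \<noteq> 0"
    by (rule leib_support)
  have "up a J = Some I" using *(2) by (simp add: string.inverse)
  then have "wt (down a) (up a) I = 1" "wt (down a) (up a) J = -1"
    using *(2) by (simp_all add: string.wt_cases)
  with * assms show "weight L = c + 2" by (force simp: homog_def wts_def)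
qed

lemma N_separated: "n \<in> N \<Longrightarrow> (\<And>F. F \<in> flags (insert x B) 2 \<Longrightarrow> n F = 0) \<Longrightarrow> n = (\<lambda>L. 0)"
  using sep unfolding separated_def by blast

lemma flags_insert_subset: "F \<in> flags (insert x B) m \<Longrightarrow> F \<in> flags B m"
  by (auto simp: flags_def between_def)

lemma between_down:
  assumes "between (insert x B) P K" "down a K = Some K'"
  shows "between B P K'"
proof -
  obtain z where z: "z \<notin> K'" "\<kappa> z = a" "K = insert z K'" and I: "order_ideal K'" "order_ideal K"
    using assms(2) by (auto simp: down_eq_Some step_def)
  have P: "z \<in> P" "x \<in> P" "\<kappa> z = \<kappa> x" using z x a order_ideal_subset[OF I(2)] by auto
  have "z \<notin> B"
    using P
  proof (cases rule: color_cases)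
    case 2
    have "x \<in> K" using assms(1) by (auto simp: between_def)
    with 2 have "x \<in> K'" using z by auto
    then show ?thesis using order_idealD'[OF I(1) _ P(1) 2] z by auto
  next
    case 3
    then show ?thesis using order_idealD'[OF B _ P(2) 3] x by auto
  qed (use x in auto)
  with assms(1) z I show ?thesis by (auto simp: between_def order_ideal_def)
qed

lemma pair_weights:
  "weight [K, L] = 1 \<Longrightarrow>
    (down a K \<noteq> None \<and> down a L = None) \<or> (down a K = None \<and> down a L \<noteq> None)"
  "weight [K, L] = -1 \<Longrightarrow>
    (up a K \<noteq> None \<and> down a L = None) \<or> (down a K = None \<and> up a L \<noteq> None)"
  "weight [K, L] = 2 \<Longrightarrow> down a K \<noteq> None \<and> down a L \<noteq> None"
  "weight [K, L] = -2 \<Longrightarrow> up a K \<noteq> None \<and> up a L \<noteq> None"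
proof -
  have *: "wt (down a) (up a) I = 1 \<and> down a I \<noteq> None \<or> wt (down a) (up a) I = 0 \<and> down a I = None \<or>
      wt (down a) (up a) I = -1 \<and> up a I \<noteq> None \<and> down a I = None" for I
    using string.exclusive(2)[of a I] by (cases "down a I"; cases "up a I") (auto simp: wt_def)
  show
    "weight [K, L] = 1 \<Longrightarrow>
    (down a K \<noteq> None \<and> down a L = None) \<or> (down a K = None \<and> down a L \<noteq> None)"
  "weight [K, L] = -1 \<Longrightarrow>
    (up a K \<noteq> None \<and> down a L = None) \<or> (down a K = None \<and> up a L \<noteq> None)"
  "weight [K, L] = 2 \<Longrightarrow> down a K \<noteq> None \<and> down a L \<noteq> None"
  "weight [K, L] = -2 \<Longrightarrow> up a K \<noteq> None \<and> up a L \<noteq> None"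
    using *[of K] *[of L] by auto
qed

lemma pair_E:
  assumes "u \<in> M" "u L \<noteq> 0"
  obtains I J where "L = [I, J]"
  using M_length[OF assms] by (auto simp: numeral_2_eq_2 length_Suc_conv)

lemma flag_E:
  assumes "F \<in> flags (insert x B) 2"
  obtains K L where "F = [K, L]" "L \<subseteq> K" "between (insert x B) P K" "between (insert x B) P L"
    "between B P K" "between B P L"
  using assms flags_insert_subset[OF assms] by (auto simp: flags_2)

lemma XX_pair:
  "X (X u) [K, L] =
    2 * (case down a K of None \<Rightarrow> 0 | Some K' \<Rightarrow> case down a L of None \<Rightarrow> 0 | Some L' \<Rightarrow> u [K', L'])"
  by (rule leib_leib_pair) (rule string.nilpotent)

text \<open>
  In negative weight, \<open>X\<close> (or \<open>X\<^sup>2\<close>) is injective and maps into positive weight, where \<open>M\<close>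
  coincides with \<open>N\<close>.
\<close>

lemma vanish_weight_minus_1:
  assumes u: "u \<in> M" "homog (-1) u" and flags: "\<And>F. F \<in> flags B 2 \<Longrightarrow> u F = 0"
  shows "u = (\<lambda>L. 0)"
proof -
  have hX: "homog 1 (X u)" using homog_X[OF u(2)] by simp
  have "X u = (\<lambda>L. 0)"
  proof (rule N_separated)
    show "X u \<in> N" using M_leib[OF u(1)] hX by (rule M_positive_weight) simp
    fix F assume "F \<in> flags (insert x B) 2"
    then show "X u F = 0"
    proof (rule flag_E)
      fix K L assume F: "F = [K, L]" "L \<subseteq> K" "between (insert x B) P K" "between (insert x B) P L"
        "between B P K" "between B P L"
      show ?thesis
      proof (rule ccontr)
        assume "X u F \<noteq> 0"
        with hX have "weight F = 1" unfolding homog_def by blast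
        then have "weight [K, L] = 1" by (simp only: F(1))
        \<comment> \<open>Weight 1 means that exactly one of the two ideals is removable, so
          \<open>X u F\<close> is a single value of \<open>u\<close>, taken at a flag above
          \<open>B\<close>.\<close>
        from pair_weights(1)[OF this] show False
        proof (elim disjE conjE)
          assume "down a K \<noteq> None" and L: "down a L = None"
          then obtain K' where K': "down a K = Some K'" by blast
          have "L \<subseteq> K'" using flag_lower_larger[OF _ F(2) K' L] F by (simp add: between_def)
          then have "[K', L] \<in> flags B 2" using between_down[OF F(3) K'] F by (simp add: flags_2)
          with flags K' L \<open>X u F \<noteq> 0\<close> show False by (simp add: F)
        next
          assume K: "down a K = None" and "down a L \<noteq> None"
          then obtain L' where L': "down a L = Some L'" by blast
          then have "L' \<subseteq> K" using F by (auto simp: down_eq_Some step_def)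
          then have "[K, L'] \<in> flags B 2" using between_down[OF F(4) L'] F by (simp add: flags_2)
          with flags K L' \<open>X u F \<noteq> 0\<close> show False by (simp add: F)
        qed
      qed
    qed
  qed
  then have X0: "X u L = 0" for L by simp
  show ?thesis
  proof (intro ext, rule ccontr)
    fix L assume "u L \<noteq> 0"
    from pair_E[OF u(1) this] obtain I J where L: "L = [I, J]" .
    \<comment> \<open>Injectivity of X in this weight: one factor can be raised and the other cannot
      be lowered, so \<open>u [I, J]\<close> is the only term of \<open>X u\<close> at the raised
      pair.\<close>
    have "weight [I, J] = -1" using u(2) \<open>u L \<noteq> 0\<close> L by (auto simp: homog_def)
    from pair_weights(2)[OF this] show False
    proof (elim disjE conjE)
      assume "up a I \<noteq> None" and J: "down a J = None"
      then obtain I' where "down a I' = Some I" by (auto simp: string.inverse)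
      with X0[of "[I', J]"] J L \<open>u L \<noteq> 0\<close> show False by simp
    next
      assume I: "down a I = None" and "up a J \<noteq> None"
      then obtain J' where "down a J' = Some J" by (auto simp: string.inverse)
      with X0[of "[I, J']"] I L \<open>u L \<noteq> 0\<close> show False by simp
    qed
  qed
qed

lemma vanish_weight_minus_2:
  assumes u: "u \<in> M" "homog (-2) u" and flags: "\<And>F. F \<in> flags B 2 \<Longrightarrow> u F = 0"
  shows "u = (\<lambda>L. 0)"
proof -
  have hX: "homog 2 (X (X u))" using homog_X[OF homog_X[OF u(2)]] by simp
  have "X (X u) = (\<lambda>L. 0)"
  proof (rule N_separated)
    show "X (X u) \<in> N" using M_leib[OF M_leib[OF u(1)]] hX by (rule M_positive_weight) simp
    fix F assume "F \<in> flags (insert x B) 2"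
    then show "X (X u) F = 0"
    proof (rule flag_E)
      fix K L assume F: "F = [K, L]" "L \<subseteq> K" "between (insert x B) P K" "between (insert x B) P L"
        "between B P K" "between B P L"
      have "u [K', L'] = 0" if "down a K = Some K'" "down a L = Some L'" for K' L'
        using flag_lower_both[OF F(2) that] between_down[OF F(3) that(1)] between_down[OF F(4) that(2)]
        by (intro flags) (simp add: flags_2)
      then show ?thesis unfolding F(1) XX_pair by (simp split: option.split)
    qed
  qed
  then have X0: "X (X u) L = 0" for L by simp
  show ?thesis
  proof (intro ext, rule ccontr)
    fix L assume "u L \<noteq> 0"
    from pair_E[OF u(1) this] obtain I J where L: "L = [I, J]" .
    have "weight [I, J] = -2" using u(2) \<open>u L \<noteq> 0\<close> L by (auto simp: homog_def)
    from pair_weights(4)[OF this] obtain I' J' where "down a I' = Some I" "down a J' = Some J"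
      by (auto simp: string.inverse)
    with X0[of "[I', J']"] L \<open>u L \<noteq> 0\<close> show False by (simp add: XX_pair del: leib.simps)
  qed
qed

text \<open>
  In weight zero, vanishing on the flags \<open>[K, L]\<close> with \<open>x \<notin> L\<close> forces the component \<open>n\<^sub>1\<close> to lie
  in \<open>X\<^sup>2 N\<close>, because the values of elements of \<open>N\<close> on flags can be prescribed; on \<open>X\<^sup>2 N\<close> in
  weight two, the operator \<open>Y\<close> stays inside \<open>N\<close>.
\<close>

lemma M_weight_0_in_N:
  assumes u: "u \<in> M" "homog 0 u" and flags: "\<And>F. F \<in> flags B 2 \<Longrightarrow> u F = 0"
  shows "u \<in> N"
  using u
proof (rule M_homog_E)
  fix n\<^sub>0 n\<^sub>1 n\<^sub>2
  assume n: "n\<^sub>0 \<in> N" "n\<^sub>1 \<in> N" "n\<^sub>2 \<in> N" "homog (0 + 2) n\<^sub>1" "homog (0 + 4) n\<^sub>2"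
    and u_eq: "\<And>L. u L = n\<^sub>0 L + Y n\<^sub>1 L + Y (Y n\<^sub>2) L"
  have "n\<^sub>2 = (\<lambda>L. 0)" using N_high_weight[OF n(3,5)] by simp
  with u_eq have u_eq: "u L = n\<^sub>0 L + Y n\<^sub>1 L" for L by (simp add: leib_zero')
  \<comment> \<open>These are the values on flags that a vector \<open>y\<close> of weight -2 must
    have for X^2 y = n_1, as X^2 contributes a factor 2. The default 0 is harmless: it concerns
    pairs of other weights, which the projection onto weight -2 kills.\<close>
  define t where "t F = (case (up a (F ! 0), up a (F ! 1)) of
      (Some K, Some L) \<Rightarrow> n\<^sub>1 [K, L] / 2 | _ \<Rightarrow> 0)" for F
  obtain y\<^sub>0 where y\<^sub>0: "y\<^sub>0 \<in> N" "\<And>F. F \<in> flags (insert x B) 2 \<Longrightarrow> y\<^sub>0 F = t F"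
    using flag_interpolation[OF B' xs] by blast
  define y where "y = (\<lambda>L. of_bool (weight L = -2) * y\<^sub>0 L)"
  have y: "y \<in> N" "homog (-2) y"
    unfolding y_def using N_weight[OF y\<^sub>0(1), of "\<lambda>c. of_bool (c = -2)"] homog_component by auto
  have "(\<lambda>L. X (X y) L - n\<^sub>1 L) = (\<lambda>L. 0)"
  proof (rule N_separated)
    show "(\<lambda>L. X (X y) L - n\<^sub>1 L) \<in> N" by (intro cyclic_diff cyclic.leib y n)
    fix F assume "F \<in> flags (insert x B) 2"
    then show "X (X y) F - n\<^sub>1 F = 0"
    proof (rule flag_E)
      fix K L assume F: "F = [K, L]" "L \<subseteq> K" "between (insert x B) P K" "between (insert x B) P L"
        "between B P K" "between B P L"
      show ?thesis
      proof (cases "\<exists>K' L'. down a K = Some K' \<and> down a L = Some L'")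
        case True
        then obtain K' L' where D: "down a K = Some K'" "down a L = Some L'" by blast
        then have U: "up a K' = Some K" "up a L' = Some L" "up a K = None"
          using D string.exclusive(1)[OF D(1)] by (simp_all add: string.inverse)
        then have "wt (down a) (up a) K' = -1" "wt (down a) (up a) L' = -1"
          by (simp_all add: string.wt_cases(2))
        then have "weight [K', L'] = -2" by simp
        have b: "between B P K'" "between B P L'" "L' \<subseteq> K'" "L' \<subseteq> K"
          using between_down[OF F(3) D(1)] between_down[OF F(4) D(2)] flag_lower_both[OF F(2) D] D F(2)
          by (auto simp: down_eq_Some step_def)
        have "2 * y [K', L'] = n\<^sub>1 [K, L]"
        proof (cases "x \<in> L'")
          case True
          with b have "[K', L'] \<in> flags (insert x B) 2" by (auto simp: flags_2 between_def)
          then show ?thesis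
            using y\<^sub>0(2) \<open>weight [K', L'] = -2\<close> U by (simp add: y_def t_def)
        next
          case False
          \<comment> \<open>Elements of \<open>N\<close> vanish here because \<open>x\<close> is
            missing from \<open>L'\<close>. As \<open>K\<close> cannot be raised, \<open>u\<close>
            at the flag \<open>[K, L']\<close> reduces to the value of \<open>n\<^sub>1\<close> at
            \<open>[K, L]\<close>, which must therefore be zero.\<close>
          then have "y [K', L'] = 0" "n\<^sub>0 [K, L'] = 0"
            using N_support[OF y(1), of "[K', L']"] N_support[OF n(1), of "[K, L']"]
            by (auto simp: between_def)
          moreover have "u [K, L'] = 0" using b F by (intro flags) (simp add: flags_2)
          then have "n\<^sub>0 [K, L'] + n\<^sub>1 [K, L] = 0" using U u_eq[of "[K, L']"] by simp
          ultimately show ?thesis by simp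
        qed
        then show ?thesis unfolding F(1) XX_pair D by simp
      next
        case False
        then have "X (X y) [K, L] = 0" unfolding XX_pair by (auto split: option.split)
        moreover have "n\<^sub>1 [K, L] = 0"
          using n(4) pair_weights(3)[of K L] False unfolding homog_def by force
        ultimately show ?thesis by (simp only: F(1)) simp
      qed
    qed
  qed
  then have "X (X y) L - n\<^sub>1 L = 0" for L by (rule fun_cong)
  then have n1: "n\<^sub>1 = X (X y)" by (intro ext) simp
  have hXy: "homog 0 (X y)" using homog_X[OF y(2)] by simp
  have XY: "X (Y v) L = Y (X v) L + of_int (weight L) * v L" for v L
    by (rule string.commutator)
  \<comment> \<open>The sl2 computation for a lowest weight vector \<open>y\<close> of weight -2: Y
    y would have weight -4, so it is zero, and the commutator gives Y X y = 2 y and then Y X^2 y = 2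
    X y, which lies in \<open>N\<close>.\<close>
  have "Y y = (\<lambda>L. 0)"
  proof (intro ext, rule ccontr)
    fix L assume "Y y L \<noteq> 0"
    then have "length L = 2" by (rule leib_length[rotated]) (use N_support y in blast)
    moreover have "weight L = -4"
    proof (rule ccontr)
      assume "weight L \<noteq> -4"
      have "(\<lambda>L. of_bool (weight L - 2 \<noteq> -4) * y L) = (\<lambda>L. 0)"
        by (rule ext) (use y(2) in \<open>auto simp: homog_def\<close>)
      then have "of_bool (weight L \<noteq> -4) * Y y L = 0"
        using string.wts_leib_h[of "\<lambda>c. of_bool (c \<noteq> -4)" a L y] by (simp only: leib_zero)
      with \<open>weight L \<noteq> -4\<close> \<open>Y y L \<noteq> 0\<close> show False by simp
    qed
    ultimately show False using weight_bounds by fastforce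
  qed
  then have "Y (X y) L = 2 * y L" for L
    using XY[of y L] y(2) by (cases "y L = 0") (auto simp: leib_zero' homog_def)
  then have YX: "Y (X y) = (\<lambda>L. 2 * y L)" by blast
  have "Y n\<^sub>1 L = 2 * X y L" for L
    using XY[of "X y" L] hXy by (cases "X y L = 0") (auto simp: n1 YX leib_scale homog_def)
  then have "u = (\<lambda>L. n\<^sub>0 L + 2 * X y L)" using u_eq by auto
  then show ?thesis
    using cyclic.add[OF n(1) cyclic.scale[OF cyclic.leib[OF y(1)]]] by simp
qed

text \<open>Each weight component of \<open>u\<close> still vanishes on flags, since a tensor has a
  single weight. Components of weight at least 0 lie in \<open>N\<close>, where the hypothesis on
  \<open>insert x B\<close> applies.\<close>

lemma separated_insert: "separated B"
  unfolding separated_def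
proof (intro ballI impI)
  fix u assume u: "u \<in> cyclic down (replicate 2 B)" and flags: "\<forall>F\<in>flags B 2. u F = 0"
  have uM: "u \<in> M" using u by (rule cyclic_subset_M)
  have "(\<lambda>L. of_bool (weight L = c) * u L) = (\<lambda>L. 0)" (is "?v = _") for c
  proof -
    have v: "?v \<in> M" "homog c ?v" and vf: "\<And>F. F \<in> flags B 2 \<Longrightarrow> ?v F = 0"
      using M_weight[OF uM, of "\<lambda>d. of_bool (d = c)"] homog_component flags by auto
    have vN: "?v = (\<lambda>L. 0)" if "?v \<in> N"
      using that vf flags_insert_subset by (intro N_separated) blast+
    consider "1 \<le> c" | "c = 0" | "c = -1" | "c = -2" | "c < -2" by linarith
    then show ?thesis
    proof cases
      case 1
      then show ?thesis using vN M_positive_weight v by blast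
    next
      case 2
      then show ?thesis using vN M_weight_0_in_N v vf by blast
    next
      case 3
      then show ?thesis using vanish_weight_minus_1 v vf by blast
    next
      case 4
      then show ?thesis using vanish_weight_minus_2 v vf by blast
    next
      case 5
      show ?thesis
      proof (intro ext, rule ccontr)
        fix L assume "?v L \<noteq> 0"
        then show False using M_length[OF v(1)] weight_bounds[of L] 5 by auto
      qed
    qed
  qed
  then have *: "of_bool (weight L = c) * u L = 0" for L c by (rule fun_cong)
  show "u = (\<lambda>L. 0)"
  proof
    fix L
    from *[of L "weight L"] show "u L = 0" by simp
  qed
qed

end

lemma separated: "completion B xs \<Longrightarrow> order_ideal B \<Longrightarrow> separated B"
proof (induction xs arbitrary: B)
  case Nil
  show ?case
    unfolding separated_def
  proof (intro ballI impI ext, rule ccontr)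
    fix u L assume u: "u \<in> cyclic down (replicate 2 B)" "\<forall>F\<in>flags B 2. u F = 0" "u L \<noteq> 0"
    from cyclic_support_above[OF u(1,3) Nil(2)] have "length L = 2" "\<forall>I\<in>set L. between B P I"
      by auto
    then obtain I J where L: "L = [I, J]" and *: "between B P I" "between B P J"
      by (auto simp: numeral_2_eq_2 length_Suc_conv)
    have "P \<subseteq> B" using Nil(1) by simp
    with * have "J \<subseteq> I" unfolding between_def by blast
    with L * have "L \<in> flags B 2" by (auto simp: flags_2)
    with u show False by simp
  qed
next
  case (Cons x xs)
  then show ?case using separated_insert[OF Cons.prems(2)] by auto
qed

end

subsection \<open>Straightening\<close>

text \<open>
  Breaks ties between tensors of equal total height: it increases when an adjacent pair \<open>I, J\<close>
  with \<open>J\<close> not contained in \<open>I\<close> is replaced by \<open>I \<union> J, I \<inter> J\<close>.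
\<close>

fun position_weight :: "'a set list \<Rightarrow> nat" where
  "position_weight [] = 0"
| "position_weight (I # T) = card I * Suc (length T) + position_weight T"

lemma position_weight_append_mono:
  "length T = length T' \<Longrightarrow> position_weight T < position_weight T' \<Longrightarrow>
     position_weight (A @ T) < position_weight (A @ T')"
  by (induction A) auto

lemma position_weight_union_inter:
  assumes "finite I" "finite J" "\<not> J \<subseteq> I"
  shows "position_weight (I # J # C) < position_weight ((I \<union> J) # (I \<inter> J) # C)"
proof -
  have "card (I \<union> J) + card (I \<inter> J) = card I + card J"
    using card_Un_Int[OF assms(1,2)] by simp
  moreover have "card I < card (I \<union> J)"
    using assms by (intro psubset_card_mono) auto
  ultimately have "(card I + card J) * Suc (length C) + card I <
      (card (I \<union> J) + card (I \<inter> J)) * Suc (length C) + card (I \<union> J)"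
    by simp
  then show ?thesis by (simp add: algebra_simps)
qed

context d_complete_poset
begin

lemma stack_Ints: "(\<And>L. u L \<in> \<int>) \<Longrightarrow> stack \<psi> xs u L \<in> \<int>"
  by (induction xs arbitrary: u) (simp_all add: stack_def dpow_Ints)

lemma flag_vector_Ints: "flag_vector B xs F L \<in> \<int>"
  unfolding flag_vector_def by (rule stack_Ints) simp

context
  fixes B :: "'a set" and xs :: "'a list"
  assumes B: "order_ideal B" and xs: "completion B xs"
begin

text \<open>Unitriangularity matches \<open>u\<close> on the flags with integral coefficients if
  \<open>u\<close> is integral; \<open>inj\<close> extends the agreement to all tensors.\<close>

lemma flag_expansion:
  assumes "u \<in> cyclic down (replicate m B)"
    and inj: "\<And>v. v \<in> cyclic down (replicate m B) \<Longrightarrow> (\<And>F. F \<in> flags B m \<Longrightarrow> v F = 0) \<Longrightarrow>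
      v = (\<lambda>L. 0)"
  obtains d where "\<And>L. u L = (\<Sum>F\<in>flags B m. d F * flag_vector B xs F L)"
    "(\<And>L. u L \<in> \<int>) \<Longrightarrow> \<forall>F\<in>flags B m. d F \<in> \<int>"
proof -
  note solve = triangular_solve[where A = "flags B m" and c = "flag_vector B xs" and r = total_height and t = u,
      OF finite_flags flag_vector_self[OF B xs, where m = m]
        flag_vector_triangular[OF B xs, where m = m]]
  from solve obtain d
    where d: "\<forall>F'\<in>flags B m. (\<Sum>F\<in>flags B m. d F * flag_vector B xs F F') = u F'"
      "(\<And>L. u L \<in> \<int>) \<Longrightarrow> \<forall>F\<in>flags B m. d F \<in> \<int>"
    using flag_vector_Ints by auto
  have "(\<lambda>L. u L - (\<Sum>F\<in>flags B m. d F * flag_vector B xs F L)) = (\<lambda>L. 0)"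
  proof (rule inj)
    show "(\<lambda>L. u L - (\<Sum>F\<in>flags B m. d F * flag_vector B xs F L)) \<in> cyclic down (replicate m B)"
      by (intro cyclic_diff assms(1) cyclic_sum cyclic.scale flag_vector_cyclic)
  qed (use d(1) in simp)
  from fun_cong[OF this] d(2) show ?thesis by (intro that) simp_all
qed

text \<open>Expand \<open>f\<close> in flag vectors. One that is nonzero at \<open>[I, J]\<close>
  belongs to a flag of larger height or, at equal height, to the flag with the same counts, which is
  \<open>[I \<union> J, I \<inter> J]\<close>. Triangularity makes exactly these coefficients
  vanish.\<close>

lemma straightening_pair:
  assumes f: "f \<in> cyclic down (replicate 2 B)" and I: "between B P I" "between B P J"
    and f0: "\<And>F. F \<in> flags B 2 \<Longrightarrow> total_height [I, J] < total_height F \<or> F = [I \<union> J, I \<inter> J] \<Longrightarrow> f F = 0"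
  shows "f [I, J] = 0"
proof -
  let ?T = "[I, J]" and ?F0 = "[I \<union> J, I \<inter> J]" and ?v = "flag_vector B xs"
  obtain d where d: "\<And>L. f L = (\<Sum>F\<in>flags B 2. d F * ?v F L)"
    by (rule flag_expansion[OF f]) (use separated[OF xs B] in \<open>auto simp: separated_def\<close>)
  have fin: "finite I" "finite J" using I order_ideal_finite by (auto simp: between_def)
  have W0: "total_height ?F0 = total_height ?T" using sum.union_inter[OF fin, of height] by simp
  have F0: "?F0 \<in> flags B 2"
    using I order_ideal_Un order_ideal_Int by (auto simp: flags_2 between_def)
  define A where "A = {F\<in>flags B 2. total_height ?T < total_height F \<or> F = ?F0}"
  have dA: "d F = 0" if "F \<in> A" for F
  proof (rule triangular_independent[where A = A and c = ?v and r = total_height, OF _ _ _ _ that])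
    show "finite A" using finite_flags by (simp add: A_def)
    show "?v F F = 1" if "F \<in> A" for F
      using that flag_vector_self[OF B xs, where m = 2] by (simp add: A_def)
    show "total_height F' < total_height F" if "F \<in> A" "F' \<in> A" "?v F F' \<noteq> 0" "F \<noteq> F'" for F F'
      using that by (intro flag_vector_triangular[OF B xs, where m = 2]) (simp_all add: A_def)
    fix F' assume F': "F' \<in> A"
    \<comment> \<open>A flag outside \<open>A\<close> is no higher than \<open>[I, J]\<close>, hence
      no higher than \<open>F'\<close>, so its vector does not reach \<open>F'\<close>.\<close>
    have "d F * ?v F F' = 0" if "F \<in> flags B 2 - A" for F
    proof -
      have "total_height ?T \<le> total_height F'" using F' W0 by (auto simp: A_def)
      then have "?v F F' = 0"
        using flag_vector_triangular[OF B xs, where m = 2 and F = F and F' = F'] that F' by (force simp: A_def)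
      then show ?thesis by simp
    qed
    then have "(\<Sum>F\<in>A. d F * ?v F F') = (\<Sum>F\<in>flags B 2. d F * ?v F F')"
      using finite_flags by (intro sum.mono_neutral_left) (auto simp: A_def)
    also have "\<dots> = 0" using f0[of F'] F' d[of F'] by (auto simp: A_def)
    finally show "(\<Sum>F\<in>A. d F * ?v F F') = 0" .
  qed
  have "d F * ?v F ?T = 0" if F: "F \<in> flags B 2" for F
  proof (cases "?v F ?T = 0")
    case False
    have "F \<in> A"
    proof (cases "total_height ?T = total_height F")
      case True
      have "cnt F x = cnt ?F0 x" if "x \<in> P - B" for x
        using flag_vector_support(2)[OF B xs F False True that] by auto
      then have "F = ?F0" by (rule flag_eqI[OF F F0])
      with F show ?thesis by (simp add: A_def)
    next
      case False
      then show ?thesis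
        using flag_vector_support(1)[OF B xs F \<open>?v F ?T \<noteq> 0\<close>] F by (simp add: A_def)
    qed
    then show ?thesis using dA by simp
  qed simp
  then show ?thesis unfolding d by (intro sum.neutral) blast
qed

text \<open>In the support take a tensor of largest total height and, among those, of largest
  position weight. It is not a flag, so some neighbors are out of order. The slice at this pair
  satisfies \<open>straightening_pair\<close> by maximality, and the coefficient is zero after
  all.\<close>

lemma vanish_on_flags:
  assumes u: "u \<in> cyclic down (replicate m B)" and flags: "\<And>F. F \<in> flags B m \<Longrightarrow> u F = 0"
  shows "u = (\<lambda>L. 0)"
proof (rule ccontr)
  assume "u \<noteq> (\<lambda>L. 0)"
  define S where "S = {T. u T \<noteq> 0}"
  have S: "length T = m" "\<forall>I\<in>set T. between B P I" if "T \<in> S" for T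
    using cyclic_support_above[OF u _ B, of T] that by (auto simp: S_def)
  then have "S \<subseteq> {T. set T \<subseteq> Pow P \<and> length T = m}" unfolding between_def by blast
  then have "finite S" by (rule finite_subset) (simp add: finite_lists_length_eq finite_poset)
  have "S \<noteq> {}" using \<open>u \<noteq> (\<lambda>L. 0)\<close> by (auto simp: S_def)
  define S' where "S' = {T\<in>S. total_height T = Max (total_height ` S)}"
  have "Max (total_height ` S) \<in> total_height ` S" using \<open>finite S\<close> \<open>S \<noteq> {}\<close> by (intro Max_in) auto
  then have S': "finite S'" "S' \<noteq> {}" using \<open>finite S\<close> by (auto simp: S'_def)
  then have "Max (position_weight ` S') \<in> position_weight ` S'" by (intro Max_in) auto
  then obtain T where T: "T \<in> S'" "position_weight T = Max (position_weight ` S')" by auto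
  have W_max: "total_height T' \<le> total_height T" if "u T' \<noteq> 0" for T'
    using that T(1) \<open>finite S\<close> by (auto simp: S'_def S_def)
  have pos_max: "position_weight T' \<le> position_weight T" if "u T' \<noteq> 0" "total_height T' = total_height T" for T'
  proof -
    have "T' \<in> S'" using that T(1) by (simp add: S'_def S_def)
    then show ?thesis using S'(1) T(2) by simp
  qed
  have "T \<in> S" "u T \<noteq> 0" using T(1) by (auto simp: S'_def S_def)
  then have "\<not> sorted_wrt (\<lambda>I J. J \<subseteq> I) T"
    using flags[of T] S[of T] by (auto simp: flags_def)
  then obtain i where i: "Suc i < length T" "\<not> T ! Suc i \<subseteq> T ! i"
    using sorted_wrt_iff_nth_Suc_transp[of "\<lambda>I J. J \<subseteq> I" T] by (auto simp: transp_def)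
  define A I J C where "A = take i T" and "I = T ! i" and "J = T ! Suc i" and "C = drop (Suc (Suc i)) T"
  have T_eq: "T = A @ [I, J] @ C"
    using i by (simp add: A_def I_def J_def C_def Cons_nth_drop_Suc)
  have IJ: "between B P I" "between B P J" "finite I" "finite J"
    using S(2)[OF \<open>T \<in> S\<close>] order_ideal_finite T_eq by (auto simp: between_def)
  have "(\<lambda>L. u (A @ L @ C)) [I, J] = 0"
  proof (rule straightening_pair)
    show "(\<lambda>L. u (A @ L @ C)) \<in> cyclic down (replicate 2 B)"
      using S(1)[OF \<open>T \<in> S\<close>] u T_eq by (intro cyclic_infix) simp
    fix F assume "F \<in> flags B 2" and F: "total_height [I, J] < total_height F \<or> F = [I \<union> J, I \<inter> J]"
    show "u (A @ F @ C) = 0"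
    proof (rule ccontr)
      assume nz: "u (A @ F @ C) \<noteq> 0"
      from F show False
      proof
        assume "total_height [I, J] < total_height F"
        with W_max[OF nz] show False unfolding T_eq by simp
      next
        assume F: "F = [I \<union> J, I \<inter> J]"
        have "total_height (A @ F @ C) = total_height T"
          unfolding T_eq F using sum.union_inter[OF IJ(3,4), of height] by simp
        from pos_max[OF nz this]
        have "position_weight (A @ F @ C) \<le> position_weight T" .
        moreover have "position_weight (A @ [I, J] @ C) < position_weight (A @ F @ C)"
          unfolding F
          by (rule position_weight_append_mono)
            (use position_weight_union_inter[OF IJ(3,4)] i(2) in \<open>simp_all add: I_def J_def\<close>)
        ultimately show False unfolding T_eq by simp
      qed
    qed
  qed (use IJ in auto)
  with T_eq \<open>u T \<noteq> 0\<close> show False by simp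
qed

end

end

subsection \<open>From multisets of ideals to tensors\<close>

lemma sum_mset_count:
  fixes f :: "'k \<Rightarrow> complex"
  assumes "finite S" "set_mset A \<subseteq> S"
  shows "(\<Sum>x\<in>#A. f x) = (\<Sum>x\<in>S. of_nat (count A x) * f x)"
  using assms(2)
proof (induction A)
  case (add y A)
  have "(\<Sum>x\<in>S. of_nat (count (add_mset y A) x) * f x) =
      (\<Sum>x\<in>S. of_nat (count A x) * f x + (if x = y then f y else 0))"
    by (intro sum.cong) (auto simp: algebra_simps)
  with add assms(1) show ?case by (simp add: sum.distrib)
qed simp

lemma lookup_sum_mset:
  "Poly_Mapping.lookup (\<Sum>x\<in>#A. f x) M = (\<Sum>x\<in>#A. Poly_Mapping.lookup (f x) M)"
  by (induction A) (simp_all add: lookup_add)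

lemma lookup_lin_extend:
  "Poly_Mapping.lookup (lin_extend f v) M =
     (\<Sum>k\<in>Poly_Mapping.keys v. Poly_Mapping.lookup v k * Poly_Mapping.lookup (f k) M)"
  by (simp add: lin_extend_def lookup_sum)

lemma lin_extend_0 [simp]: "lin_extend f 0 = 0"
  by (simp add: lin_extend_def)

lemma lin_extend_single [simp]: "lin_extend f (Poly_Mapping.single k 1) = f k"
  by (auto intro!: poly_mapping_eqI simp: lin_extend_def)

lemma leib_sum: "leib g (\<lambda>L. \<Sum>i\<in>A. u i L) L = (\<Sum>i\<in>A. leib g (u i) L)"
  by (induction A rule: infinite_finite_induct) (simp_all add: leib_add)

lemma leib_mset:
  "leib g (\<lambda>L. f (mset L)) L =
     (\<Sum>J\<in>#mset L. case g J of None \<Rightarrow> 0 | Some I \<Rightarrow> f (add_mset I (mset L - {#J#})))"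
proof (induction L arbitrary: f)
  case (Cons K L)
  have "(\<Sum>J\<in>#mset L. case g J of None \<Rightarrow> 0 | Some I \<Rightarrow> f (add_mset K (add_mset I (mset L - {#J#})))) =
    (\<Sum>J\<in>#mset L. case g J of None \<Rightarrow> 0 | Some I \<Rightarrow> f (add_mset I (mset (K # L) - {#J#})))"
    by (intro arg_cong[where f = sum_mset] image_mset_cong)
      (auto split: option.split simp: add_mset_commute)
  with Cons[of "\<lambda>M. f (add_mset K M)"] show ?case by (simp split: option.split)
qed simp

text \<open>
  The symmetric tensor corresponding to a multiset \<open>M\<close> is the average over all its orderings; with
  this normalisation divided powers act with integer coefficients.
\<close>

definition tensor_coeff :: "('k multiset \<Rightarrow>\<^sub>0 complex) \<Rightarrow> 'k list \<Rightarrow> complex" where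
  "tensor_coeff v L = Poly_Mapping.lookup v (mset L) / of_nat (card (permutations_of_multiset (mset L)))"

lemma card_permutations_nonzero: "card (permutations_of_multiset A) \<noteq> 0"
  using card_permutations_of_multiset_aux[of A] by (metis fact_nonzero mult_is_0)

lemma tensor_coeff_eq_0_iff: "tensor_coeff v L = 0 \<longleftrightarrow> Poly_Mapping.lookup v (mset L) = 0"
  using card_permutations_nonzero by (simp add: tensor_coeff_def)

lemma tensor_coeff_inject:
  fixes v w :: "'k multiset \<Rightarrow>\<^sub>0 complex"
  assumes "tensor_coeff v = tensor_coeff w"
  shows "v = w"
proof (rule poly_mapping_eqI)
  fix M :: "'k multiset"
  obtain L where "M = mset L" using ex_mset by metis
  then show "Poly_Mapping.lookup v M = Poly_Mapping.lookup w M"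
    using fun_cong[OF assms, of L] card_permutations_nonzero by (simp add: tensor_coeff_def)
qed

lemma tensor_coeff_cscale: "tensor_coeff (cscale c v) L = c * tensor_coeff v L"
  by (simp add: tensor_coeff_def)

lemma tensor_coeff_sum: "tensor_coeff (\<Sum>i\<in>A. v i) L = (\<Sum>i\<in>A. tensor_coeff (v i) L)"
  by (simp add: tensor_coeff_def lookup_sum sum_divide_distrib)

lemma tensor_coeff_empty_ideals: "tensor_coeff (empty_ideals m) = (\<lambda>L. of_bool (L = replicate m {}))"
proof
  fix L :: "'b set list"
  have eq: "mset K = replicate_mset m {} \<longleftrightarrow> K = replicate m {}" for K :: "'b set list"
  proof
    assume *: "mset K = replicate_mset m {}"
    show "K = replicate m {}"
    proof (rule replicate_eqI)
      show "length K = m" using * by (metis size_mset size_replicate_mset)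
      show "I = {}" if "I \<in> set K" for I
        using that * by (metis in_replicate_mset set_mset_mset)
    qed
  qed simp
  have "permutations_of_multiset (replicate_mset m ({} :: 'b set)) = {replicate m {}}"
    by (simp add: permutations_of_multiset_def eq)
  moreover have "Poly_Mapping.lookup (empty_ideals m) (mset L) = of_bool (L = replicate m {})"
    unfolding eq[symmetric] empty_ideals_def lookup_single when_def by auto
  ultimately show "tensor_coeff (empty_ideals m) L = of_bool (L = replicate m {})"
    by (cases "L = replicate m {}") (simp_all add: tensor_coeff_def)
qed

text \<open>For either element, the orderings of the enlarged multiset times the multiplicity of
  that element give the same number: \<open>size A + 1\<close> times the orderings of
  \<open>A\<close>.\<close>

lemma card_permutations_exchange:
  "of_nat (count (add_mset I A) I) / of_nat (card (permutations_of_multiset (add_mset J A))) =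
   (of_nat (count (add_mset J A) J) / of_nat (card (permutations_of_multiset (add_mset I A))) :: complex)"
proof -
  have "card (permutations_of_multiset (add_mset I A)) * (count A I + 1) =
      card (permutations_of_multiset (add_mset J A)) * (count A J + 1)"
    using card_permutations_of_multiset_insert_aux[of A I] card_permutations_of_multiset_insert_aux[of A J]
    by simp
  then have "of_nat (card (permutations_of_multiset (add_mset I A))) * (of_nat (count A I) + 1) =
      (of_nat (card (permutations_of_multiset (add_mset J A))) * (of_nat (count A J) + 1) :: complex)"
    by (metis of_nat_1 of_nat_add of_nat_mult)
  then show ?thesis
    using card_permutations_nonzero[of "add_mset I A"] card_permutations_nonzero[of "add_mset J A"]
    by (simp add: divide_simps algebra_simps)
qed

context sl2_string
begin

text \<open>One matrix entry of the operator on multisets, compared with the action on the averaged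
  tensor of \<open>N\<close>. Passing from \<open>N\<close> to \<open>M\<close> replaces
  \<open>I\<close> by \<open>J\<close>, and the two multiplicities are balanced by the numbers of
  orderings.\<close>

lemma transpose_mset:
  "(\<Sum>I\<in>#N. case h I of None \<Rightarrow> 0 | Some J \<Rightarrow> of_bool (add_mset J (N - {#I#}) = M))
      / of_nat (card (permutations_of_multiset M)) =
   ((\<Sum>J\<in>#M. case g J of None \<Rightarrow> 0 | Some I \<Rightarrow>
      of_bool (add_mset I (M - {#J#}) = N) / of_nat (card (permutations_of_multiset N))) :: complex)"
proof -
  let ?cM = "of_nat (card (permutations_of_multiset M)) :: complex"
  let ?cN = "of_nat (card (permutations_of_multiset N)) :: complex"
  define S where "S = {I\<in>set_mset N. \<exists>J. h I = Some J \<and> add_mset J (N - {#I#}) = M}"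
  define T where "T = {J\<in>set_mset M. \<exists>I. g J = Some I \<and> add_mset I (M - {#J#}) = N}"
  have "(\<Sum>I\<in>#N. case h I of None \<Rightarrow> 0 | Some J \<Rightarrow> of_bool (add_mset J (N - {#I#}) = M)) =
    (\<Sum>I\<in>set_mset N. of_nat (count N I) *
      (case h I of None \<Rightarrow> (0 :: complex) | Some J \<Rightarrow> of_bool (add_mset J (N - {#I#}) = M)))"
    by (rule sum_mset_count) auto
  also have "\<dots> = (\<Sum>I\<in>S. of_nat (count N I))"
    by (rule sum.mono_neutral_cong_right) (auto simp: S_def split: option.splits)
  finally have 1: "(\<Sum>I\<in>#N. case h I of None \<Rightarrow> 0 | Some J \<Rightarrow> of_bool (add_mset J (N - {#I#}) = M)) =
    (\<Sum>I\<in>S. (of_nat (count N I) :: complex))" .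
  have "(\<Sum>J\<in>#M. case g J of None \<Rightarrow> 0 | Some I \<Rightarrow> of_bool (add_mset I (M - {#J#}) = N) / ?cN) =
    (\<Sum>J\<in>set_mset M. of_nat (count M J) *
      (case g J of None \<Rightarrow> 0 | Some I \<Rightarrow> of_bool (add_mset I (M - {#J#}) = N) / ?cN))"
    by (rule sum_mset_count) auto
  also have "\<dots> = (\<Sum>J\<in>T. of_nat (count M J) / ?cN)"
    by (rule sum.mono_neutral_cong_right) (auto simp: T_def split: option.splits)
  also have "\<dots> = (\<Sum>I\<in>S. of_nat (count N I) / ?cM)"
  proof (rule sum.reindex_bij_witness[where i = "\<lambda>I. the (h I)" and j = "\<lambda>J. the (g J)"])
    fix J assume "J \<in> T"
    then obtain I where J: "J \<in># M" "g J = Some I" "N = add_mset I (M - {#J#})"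
      by (auto simp: T_def)
    then have hI: "h I = Some J" by (simp add: inverse)
    then show "the (h (the (g J))) = J" using J by simp
    show "the (g J) \<in> S" using J hI by (simp add: S_def)
    show "of_nat (count N (the (g J))) / ?cM = of_nat (count M J) / ?cN"
      using card_permutations_exchange[of I "M - {#J#}" J] J by simp
  next
    fix I assume "I \<in> S"
    then obtain J where I: "I \<in># N" "h I = Some J" "M = add_mset J (N - {#I#})"
      by (auto simp: S_def)
    then have gJ: "g J = Some I" by (simp add: inverse)
    then show "the (g (the (h I))) = I" using I by simp
    show "the (h I) \<in> T" using I gJ by (simp add: T_def)
  qed
  finally show ?thesis by (simp add: 1 sum_divide_distrib)
qed

end

section \<open>Color operators on symmetric tensors\<close>

context d_complete_poset
begin

definition ideal_vector :: "('a set multiset \<Rightarrow>\<^sub>0 complex) \<Rightarrow> bool" where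
  "ideal_vector v \<longleftrightarrow> (\<forall>M\<in>Poly_Mapping.keys v. \<forall>I\<in>#M. order_ideal I)"

lemma ideal_op_eq:
  assumes I: "order_ideal I"
  shows "ideal_op P \<kappa> a I = (case up a I of None \<Rightarrow> 0 | Some J \<Rightarrow> Poly_Mapping.single J 1)"
proof -
  define Z where "Z = {x. x \<in> P - I \<and> \<kappa> x = a \<and> \<not> (\<exists>y\<in>P - I. y < x)}"
  have op: "ideal_op P \<kappa> a I = (\<Sum>x\<in>Z. Poly_Mapping.single (insert x I) 1)"
    by (simp add: ideal_op_def Z_def)
  have step: "step a I (insert x I)" if "x \<in> Z" for x
    unfolding step_def
  proof (intro conjI exI I)
    show "order_ideal (insert x I)"
      using I that unfolding order_ideal_def by (auto simp: order_le_less Z_def)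
  qed (use that in \<open>auto simp: Z_def\<close>)
  show ?thesis
  proof (cases "up a I")
    case None
    have "x \<notin> Z" for x using step[of x] None by (auto simp flip: up_eq_Some)
    then have "Z = {}" by blast
    with None op show ?thesis by simp
  next
    case (Some J)
    then have "up a I \<noteq> None" by simp
    then obtain z where z: "z \<in> Z" unfolding addable_iff[OF I] by (auto simp: Z_def)
    have "x = z" if "x \<in> Z" for x
    proof -
      have "insert x I = insert z I" using step_unique_upper[OF step[OF that] step[OF z]] .
      with that show ?thesis by (auto simp: Z_def)
    qed
    with z have "Z = {z}" by blast
    moreover have "J = insert z I" using Some step[OF z] by (simp flip: up_eq_Some)
    ultimately show ?thesis using Some op by simp
  qed
qed

lemma lookup_multi_op:
  assumes "\<forall>I\<in>#N. order_ideal I"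
  shows "Poly_Mapping.lookup (multi_op P \<kappa> a N) M =
    (\<Sum>I\<in>#N. case up a I of None \<Rightarrow> 0 | Some J \<Rightarrow> of_bool (add_mset J (N - {#I#}) = M))"
  unfolding multi_op_def lookup_sum_mset
  by (intro arg_cong[where f = sum_mset] image_mset_cong)
    (use assms in \<open>auto simp: ideal_op_eq lookup_single when_def split: option.split\<close>)

lemma tensor_coeff_color_op:
  assumes "ideal_vector v"
  shows "tensor_coeff (color_op P \<kappa> a v) = leib (down a) (tensor_coeff v)"
proof
  fix L
  let ?c = "\<lambda>M. of_nat (card (permutations_of_multiset M)) :: complex"
  have "tensor_coeff v L = (\<Sum>N\<in>Poly_Mapping.keys v. Poly_Mapping.lookup v N * (of_bool (mset L = N) / ?c N))" for L
  proof -
    have "(\<Sum>N\<in>Poly_Mapping.keys v. Poly_Mapping.lookup v N * (of_bool (mset L = N) / ?c N)) =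
        (\<Sum>N\<in>Poly_Mapping.keys v. if N = mset L then tensor_coeff v L else 0)"
      by (intro sum.cong) (auto simp: tensor_coeff_def)
    then show ?thesis by (simp add: tensor_coeff_eq_0_iff in_keys_iff)
  qed
  then have v: "tensor_coeff v =
      (\<lambda>L. \<Sum>N\<in>Poly_Mapping.keys v. Poly_Mapping.lookup v N * (of_bool (mset L = N) / ?c N))"
    by blast
  have "tensor_coeff (color_op P \<kappa> a v) L =
      (\<Sum>N\<in>Poly_Mapping.keys v. Poly_Mapping.lookup v N *
        (Poly_Mapping.lookup (multi_op P \<kappa> a N) (mset L) / ?c (mset L)))"
    by (simp add: tensor_coeff_def color_op_def lookup_lin_extend sum_divide_distrib)
  also have "\<dots> = (\<Sum>N\<in>Poly_Mapping.keys v. Poly_Mapping.lookup v N *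
        leib (down a) (\<lambda>L. of_bool (mset L = N) / ?c N) L)"
  proof (intro sum.cong refl)
    fix N assume "N \<in> Poly_Mapping.keys v"
    then have N: "\<forall>I\<in>#N. order_ideal I" using assms by (simp add: ideal_vector_def)
    have "Poly_Mapping.lookup (multi_op P \<kappa> a N) (mset L) / ?c (mset L) =
        leib (down a) (\<lambda>L. of_bool (mset L = N) / ?c N) L"
      unfolding lookup_multi_op[OF N] string.transpose_mset
      by (rule leib_mset[where f = "\<lambda>M. of_bool (M = N) / ?c N", symmetric])
    then show "Poly_Mapping.lookup v N *
        (Poly_Mapping.lookup (multi_op P \<kappa> a N) (mset L) / ?c (mset L)) =
      Poly_Mapping.lookup v N * leib (down a) (\<lambda>L. of_bool (mset L = N) / ?c N) L" by simp
  qed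
  also have "\<dots> = leib (down a) (tensor_coeff v) L"
    unfolding v leib_sum leib_scale ..
  finally show "tensor_coeff (color_op P \<kappa> a v) L = leib (down a) (tensor_coeff v) L" .
qed

lemma ideal_vector_iff: "ideal_vector v \<longleftrightarrow> (\<forall>L. tensor_coeff v L \<noteq> 0 \<longrightarrow> (\<forall>I\<in>set L. order_ideal I))"
proof -
  have "(\<forall>M. Q M) \<longleftrightarrow> (\<forall>L. Q (mset L))" for Q :: "'a set multiset \<Rightarrow> bool"
    by (metis ex_mset)
  from this[of "\<lambda>M. M \<in> Poly_Mapping.keys v \<longrightarrow> (\<forall>I\<in>#M. order_ideal I)"] show ?thesis
    by (simp add: ideal_vector_def Ball_def tensor_coeff_eq_0_iff in_keys_iff)
qed

lemma ideal_vector_color_op: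
  assumes "ideal_vector v"
  shows "ideal_vector (color_op P \<kappa> a v)"
  unfolding ideal_vector_iff tensor_coeff_color_op[OF assms]
proof (intro allI impI)
  fix L assume "leib (down a) (tensor_coeff v) L \<noteq> 0"
  then obtain A I J C where L: "L = A @ I # C" "down a I = Some J" "tensor_coeff v (A @ J # C) \<noteq> 0"
    by (rule leib_support)
  then have "\<forall>K\<in>set (A @ J # C). order_ideal K" using assms unfolding ideal_vector_iff by blast
  moreover have "order_ideal I" using L(2) by (simp add: down_eq_Some step_def)
  ultimately show "\<forall>K\<in>set L. order_ideal K" using L(1) by auto
qed

lemma tensor_coeff_divided_power:
  assumes "ideal_vector v"
  shows "tensor_coeff (divided_power P \<kappa> (a, k) v) = dpow (down a) k (tensor_coeff v)"
    and "ideal_vector (divided_power P \<kappa> (a, k) v)"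
proof -
  have pow: "tensor_coeff ((color_op P \<kappa> a ^^ k) v) = (leib (down a) ^^ k) (tensor_coeff v) \<and>
      ideal_vector ((color_op P \<kappa> a ^^ k) v)"
    using assms by (induction k) (simp_all add: tensor_coeff_color_op ideal_vector_color_op)
  then have "tensor_coeff (divided_power P \<kappa> (a, k) v) L = dpow (down a) k (tensor_coeff v) L" for L
    by (simp add: divided_power_def tensor_coeff_cscale string.dpow_power)
  then show "tensor_coeff (divided_power P \<kappa> (a, k) v) = dpow (down a) k (tensor_coeff v)" by blast
  from pow show "ideal_vector (divided_power P \<kappa> (a, k) v)"
    by (simp add: ideal_vector_iff divided_power_def tensor_coeff_cscale)
qed

lemma tensor_coeff_word_op:
  assumes "ideal_vector v"
  shows "tensor_coeff (word_op P \<kappa> w v) = foldr (\<lambda>(a, k). dpow (down a) k) w (tensor_coeff v) \<and>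
    ideal_vector (word_op P \<kappa> w v)"
proof (induction w)
  case (Cons p w)
  obtain a k where "p = (a, k)" by fastforce
  with Cons show ?case
    using tensor_coeff_divided_power[of "word_op P \<kappa> w v" a k] by (simp add: word_op_def)
qed (use assms in \<open>simp add: word_op_def\<close>)

lemma order_ideal_empty: "order_ideal {}"
  by (simp add: order_ideal_def)

lemma ideal_vector_empty_ideals: "ideal_vector (empty_ideals m)"
  unfolding ideal_vector_iff tensor_coeff_empty_ideals by (auto simp: order_ideal_empty)

lemma tensor_coeff_stackwise_vector:
  "tensor_coeff (stackwise_vector P \<kappa> xs m \<psi>) = stack \<psi> xs (\<lambda>L. of_bool (L = replicate m {}))"
proof -
  have "foldr (\<lambda>(a, k). dpow (down a) k) (rev (map (\<lambda>x. (\<kappa> x, \<psi> x)) xs)) u = stack \<psi> xs u" for u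
    by (simp add: stack_def foldr_conv_fold fold_map o_def)
  then show ?thesis
    using tensor_coeff_word_op[OF ideal_vector_empty_ideals]
    by (simp add: stackwise_vector_def tensor_coeff_empty_ideals)
qed

lemma tensor_coeff_generated_vector:
  assumes "v \<in> generated_vectors \<Gamma> P \<kappa> m"
  shows "tensor_coeff v \<in> cyclic down (replicate m {})" and "tensor_coeff v L \<in> \<int>"
proof -
  from assms obtain w where "v = word_op P \<kappa> w (empty_ideals m)"
    by (auto simp: generated_vectors_def)
  then have v: "tensor_coeff v = foldr (\<lambda>(a, k). dpow (down a) k) w (\<lambda>L. of_bool (L = replicate m {}))"
    using tensor_coeff_word_op[OF ideal_vector_empty_ideals] by (simp add: tensor_coeff_empty_ideals)
  have "foldr (\<lambda>(a, k). dpow (down a) k) w (\<lambda>L. of_bool (L = replicate m {})) \<in> cyclic down (replicate m {})"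
    by (induction w) (auto intro: cyclic.base cyclic_dpow)
  with v show "tensor_coeff v \<in> cyclic down (replicate m {})" by simp
  have "foldr (\<lambda>(a, k). dpow (down a) k) w (\<lambda>L. of_bool (L = replicate m {})) L \<in> \<int>"
    by (induction w arbitrary: L) (auto intro!: dpow_Ints)
  with v show "tensor_coeff v L \<in> \<int>" by simp
qed

section \<open>P-partitions as flags\<close>

definition flag_of :: "nat \<Rightarrow> ('a \<Rightarrow> nat) \<Rightarrow> 'a set list" where
  "flag_of m \<psi> = map (\<lambda>k. {x\<in>P. k < \<psi> x}) [0..<m]"

text \<open>Positions count from 0, so entry \<open>k\<close> is the ideal where the partition is at
  least \<open>k + 1\<close>, and \<open>x\<close> lies in the first \<open>\<psi> x\<close>
  entries.\<close>

lemma cnt_flag_of: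
  assumes "\<psi> \<in> bounded_partitions P m" "x \<in> P"
  shows "cnt (flag_of m \<psi>) x = \<psi> x"
proof -
  have "\<psi> x \<le> m" using assms by (auto simp: bounded_partitions_def PiE_def Pi_def)
  have "length (filter (\<lambda>k. k < n) [0..<m]) = n" if "n \<le> m" for n
    using that by (induction m) (auto simp: le_Suc_eq filter_id_conv)
  with \<open>\<psi> x \<le> m\<close> show ?thesis
    using assms(2) by (simp add: cnt_def flag_of_def filter_map o_def)
qed

lemma flag_of_in_flags:
  assumes "\<psi> \<in> bounded_partitions P m"
  shows "flag_of m \<psi> \<in> flags {} m"
proof -
  have "antimono_on P \<psi>" using assms by (simp add: bounded_partitions_def)
  then have "order_ideal {x\<in>P. k < \<psi> x}" for k
    unfolding order_ideal_def by (auto simp: monotone_on_def dest: less_le_trans)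
  moreover have "sorted_wrt (\<lambda>I J. J \<subseteq> I) (flag_of m \<psi>)"
    unfolding flag_of_def by (auto simp: sorted_wrt_iff_nth_less)
  ultimately show ?thesis by (auto simp: flags_def between_def flag_of_def)
qed

lemma bij_betw_flag_of: "bij_betw (flag_of m) (bounded_partitions P m) (flags {} m)"
proof (rule bij_betw_byWitness[where f' = "\<lambda>F. restrict (cnt F) P"])
  have "\<psi> \<in> extensional P" if "\<psi> \<in> bounded_partitions P m" for \<psi>
    using that by (auto simp: bounded_partitions_def PiE_def)
  then show "\<forall>\<psi>\<in>bounded_partitions P m. restrict (cnt (flag_of m \<psi>)) P = \<psi>"
    by (auto intro!: extensionalityI[of _ P] simp: cnt_flag_of)
  show "flag_of m ` bounded_partitions P m \<subseteq> flags {} m"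
    using flag_of_in_flags by blast
  have bp: "restrict (cnt F) P \<in> bounded_partitions P m" if F: "F \<in> flags {} m" for F
  proof -
    have "cnt F y \<le> cnt F x" if "x \<in> P" "x \<le> y" for x y
    proof -
      have "\<forall>I\<in>set F. order_ideal I" using F by (auto simp: flags_def between_def)
      then show ?thesis
        using order_idealD[OF _ _ that] by (induction F) auto
    qed
    moreover have "cnt F x \<le> m" for x using F cnt_le[of F x] by (simp add: flags_def)
    ultimately show ?thesis by (auto simp: bounded_partitions_def monotone_on_def)
  qed
  then show "(\<lambda>F. restrict (cnt F) P) ` flags {} m \<subseteq> bounded_partitions P m" by blast
  show "\<forall>F\<in>flags {} m. flag_of m (restrict (cnt F) P) = F"
    using flag_of_in_flags[OF bp] cnt_flag_of[OF bp] by (auto intro!: flag_eqI[where B = "{}"])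
qed

lemma completion_linear_extension:
  assumes "linear_extension P (ys @ zs)"
  shows "completion (set ys) zs"
  using assms
proof (induction zs arbitrary: ys)
  case (Cons z zs)
  let ?xs = "ys @ z # zs"
  have xs: "distinct ?xs" "set ?xs = P"
    and ord: "\<And>i j. i < length ?xs \<Longrightarrow> j < length ?xs \<Longrightarrow> ?xs ! i < ?xs ! j \<Longrightarrow> i < j"
    using Cons.prems unfolding linear_extension_def by blast+
  have "w \<in> insert z (set ys)" if v: "v \<in> insert z (set ys)" and w: "w \<in> P" "w \<le> v" for v w
  proof (cases "w = v")
    case False
    with w have "w < v" by simp
    from v have "v \<in> set (ys @ [z])" by simp
    then obtain j where j: "j < Suc (length ys)" "(ys @ [z]) ! j = v"
      by (auto simp: in_set_conv_nth simp del: set_append)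
    have vj: "?xs ! j = v" using j by (auto simp: nth_append less_Suc_eq)
    from w xs obtain i where i: "i < length ?xs" "?xs ! i = w" by (metis in_set_conv_nth)
    have "i < j" using ord[of i j] i j vj \<open>w < v\<close> by simp
    then have "w = ys ! i" "i < length ys" using i j by (auto simp: nth_append)
    then show ?thesis by simp
  qed (use v in simp)
  moreover have "insert z (set ys) \<subseteq> P" using xs by auto
  ultimately have "order_ideal (insert z (set ys))" unfolding order_ideal_def by blast
  with Cons.IH[of "ys @ [z]"] Cons.prems xs show ?case by auto
qed (simp add: linear_extension_def)

section \<open>Linear independence and integral spanning\<close>

lemma stack_cong: "(\<And>x. x \<in> set xs \<Longrightarrow> \<psi> x = \<phi> x) \<Longrightarrow> stack \<psi> xs u = stack \<phi> xs u"
  unfolding stack_def by (intro fold_cong) auto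

lemma standard: "standard_poset \<Gamma> P \<kappa>"
  unfolding standard_poset_def
proof (intro allI impI conjI)
  fix m :: nat and xs assume "linear_extension P xs"
  let ?sv = "stackwise_vector P \<kappa> xs m" and ?BP = "bounded_partitions P m"
  have xs: "completion {} xs" and set_xs: "set xs = P"
    using completion_linear_extension[of "[]" xs] \<open>linear_extension P xs\<close>
    by (simp_all add: linear_extension_def)
  note B = order_ideal_empty
  have sv: "tensor_coeff (?sv \<psi>) = flag_vector {} xs (flag_of m \<psi>)" if "\<psi> \<in> ?BP" for \<psi>
  proof -
    have "stack \<psi> xs = stack (cnt (flag_of m \<psi>)) xs"
      using stack_cong[of xs \<psi> "cnt (flag_of m \<psi>)"] cnt_flag_of[OF that] set_xs by auto
    then show ?thesis by (simp add: tensor_coeff_stackwise_vector flag_vector_def flag_of_def)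
  qed
  have finite: "finite ?BP"
    using bij_betw_finite[OF bij_betw_flag_of] finite_flags by blast
  have inj_flag: "inj_on (flag_of m) ?BP" using bij_betw_flag_of by (rule bij_betw_imp_inj_on)
  have independent: "d \<psi> = 0" if "(\<Sum>\<psi>\<in>?BP. cscale (d \<psi>) (?sv \<psi>)) = 0" "\<psi> \<in> ?BP" for d \<psi>
  proof (rule triangular_independent[where A = ?BP and r = "\<lambda>\<psi>. total_height (flag_of m \<psi>)"
        and c = "\<lambda>\<psi> \<phi>. flag_vector {} xs (flag_of m \<psi>) (flag_of m \<phi>)"])
    show "flag_vector {} xs (flag_of m \<psi>) (flag_of m \<psi>) = 1" if "\<psi> \<in> ?BP" for \<psi>
      using flag_vector_self[OF B xs flag_of_in_flags[OF that]] .
    show "total_height (flag_of m \<phi>) < total_height (flag_of m \<psi>)"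
      if "\<psi> \<in> ?BP" "\<phi> \<in> ?BP" "flag_vector {} xs (flag_of m \<psi>) (flag_of m \<phi>) \<noteq> 0" "\<psi> \<noteq> \<phi>" for \<psi> \<phi>
      using flag_vector_triangular[OF B xs flag_of_in_flags[OF that(1)] flag_of_in_flags[OF that(2)]]
        that inj_onD[OF inj_flag] by blast
    fix \<phi> assume "\<phi> \<in> ?BP"
    have "(\<Sum>\<psi>\<in>?BP. d \<psi> * flag_vector {} xs (flag_of m \<psi>) (flag_of m \<phi>)) =
        tensor_coeff (\<Sum>\<psi>\<in>?BP. cscale (d \<psi>) (?sv \<psi>)) (flag_of m \<phi>)"
      unfolding tensor_coeff_sum tensor_coeff_cscale by (intro sum.cong) (simp_all add: sv)
    also have "\<dots> = 0" using that(1) by (simp add: tensor_coeff_def)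
    finally show "(\<Sum>\<psi>\<in>?BP. d \<psi> * flag_vector {} xs (flag_of m \<psi>) (flag_of m \<phi>)) = 0" .
  qed (use finite that in auto)
  show inj: "inj_on ?sv ?BP"
  proof (rule inj_onI, rule ccontr)
    fix \<psi> \<phi> assume *: "\<psi> \<in> ?BP" "\<phi> \<in> ?BP" "?sv \<psi> = ?sv \<phi>" "\<psi> \<noteq> \<phi>"
    define d :: "('a \<Rightarrow> nat) \<Rightarrow> complex" where "d \<chi> = of_bool (\<chi> = \<psi>) - of_bool (\<chi> = \<phi>)" for \<chi>
    have "(\<Sum>\<chi>\<in>?BP. cscale (d \<chi>) (?sv \<chi>)) =
        (\<Sum>\<chi>\<in>?BP. (if \<chi> = \<psi> then ?sv \<psi> else 0) - (if \<chi> = \<phi> then ?sv \<phi> else 0))"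
      using *(4) by (intro sum.cong) (simp_all add: d_def)
    also have "\<dots> = 0" using finite *(1-3) by (simp add: sum_subtractf)
    finally have "d \<psi> = 0" using independent[of d \<psi>] * by simp
    with *(4) show False by (simp add: d_def)
  qed
  show "formal.independent (?sv ` ?BP)"
  proof
    assume "formal.dependent (?sv ` ?BP)"
    then obtain c v where c: "v \<in> ?sv ` ?BP" "c v \<noteq> 0" "(\<Sum>v\<in>?sv ` ?BP. cscale (c v) v) = 0"
      using formal.dependent_finite[of "?sv ` ?BP"] finite by auto
    have "(\<Sum>\<psi>\<in>?BP. cscale (c (?sv \<psi>)) (?sv \<psi>)) = 0"
      using c(3) by (simp add: sum.reindex[OF inj])
    from independent[OF this] c(1,2) show False by auto
  qed
  show "\<forall>v\<in>generated_vectors \<Gamma> P \<kappa> m. \<exists>c :: ('a \<Rightarrow> nat) \<Rightarrow> int.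
    v = (\<Sum>\<psi>\<in>?BP. cscale (of_int (c \<psi>)) (?sv \<psi>))"
  proof
    fix v assume v: "v \<in> generated_vectors \<Gamma> P \<kappa> m"
    obtain d where d: "\<And>L. tensor_coeff v L = (\<Sum>F\<in>flags {} m. d F * flag_vector {} xs F L)"
      "\<forall>F\<in>flags {} m. d F \<in> \<int>"
    proof (rule flag_expansion[OF B xs tensor_coeff_generated_vector(1)[OF v]])
      show "w = (\<lambda>L. 0)"
        if "w \<in> cyclic down (replicate m {})" "\<And>F. F \<in> flags {} m \<Longrightarrow> w F = 0" for w
        using that by (rule vanish_on_flags[OF B xs])
    qed (use tensor_coeff_generated_vector(2)[OF v] in blast)
    \<comment> \<open>The coefficients are complex numbers known to be integers; the floor of the
      real part recovers them.\<close>
    define c where "c \<psi> = \<lfloor>Re (d (flag_of m \<psi>))\<rfloor>" for \<psi>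
    have c: "of_int (c \<psi>) = d (flag_of m \<psi>)" if "\<psi> \<in> ?BP" for \<psi>
      using d(2) flag_of_in_flags[OF that] by (auto simp: c_def elim!: Ints_cases)
    have "tensor_coeff v L = tensor_coeff (\<Sum>\<psi>\<in>?BP. cscale (of_int (c \<psi>)) (?sv \<psi>)) L" for L
    proof -
      have "tensor_coeff v L = (\<Sum>\<psi>\<in>?BP. d (flag_of m \<psi>) * flag_vector {} xs (flag_of m \<psi>) L)"
        unfolding d(1) by (rule sum.reindex_bij_betw[OF bij_betw_flag_of, symmetric])
      also have "\<dots> = (\<Sum>\<psi>\<in>?BP. of_int (c \<psi>) * tensor_coeff (?sv \<psi>) L)"
        by (intro sum.cong) (simp_all add: c sv)
      finally show ?thesis by (simp add: tensor_coeff_sum tensor_coeff_cscale)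
    qed
    then show "\<exists>c :: ('a \<Rightarrow> nat) \<Rightarrow> int. v = (\<Sum>\<psi>\<in>?BP. cscale (of_int (c \<psi>)) (?sv \<psi>))"
      by (intro exI[of _ c] tensor_coeff_inject) blast
  qed
qed

end

theorem theorem8p1:
  fixes \<Gamma> :: "'c pair_pre_digraph"
    and P :: "'a::order set"
    and \<kappa> :: "'a \<Rightarrow> 'c"
  assumes "colored_poset \<Gamma> P \<kappa>"
    and "P \<noteq> {}"
    and "connected_poset P"
    and "colored_d_complete \<Gamma> P \<kappa> \<or> colored_minuscule \<Gamma> P \<kappa>"
  shows "standard_poset \<Gamma> P \<kappa>"
proof -
  have "colored_d_complete \<Gamma> P \<kappa>"
    using assms(4) colored_minuscule.axioms(1) by blast
  then interpret d_complete_poset \<Gamma> P \<kappa>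
    by (rule d_complete_poset.intro)
  show ?thesis by (rule standard)
qed

end
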